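(* Let $\mathcal{L}$ be a progressive PCTL fragment, $M=(S,P,v)$ a finite Markov chain, $s\in S$, and $X$ a finite subset of $\mathcal{L}$ such that $X=UC_s(X)$ and $s\models\varphi$ for every $\varphi\in X$. Then there exist a Markov chain $M'=(S',P',v')$ and a state $s'\in S'$ such that $|S'|\leq 2^{b(X)}\cdot\frac{b(X)^{\|X\|_s+1}-1}{b(X)-1}$ and $s'\models\varphi$ for every $\varphi\in X$.
   Context: Fix a set $AP$ of atomic propositions. PCTL state formulae $\varphi ::= a \mid \neg a \mid \varphi\wedge\varphi \mid \varphi\vee\varphi \mid P(\Phi)\triangleright r$, path formulae $\Phi ::= \mathrm{F}\varphi \mid \mathrm{G}\varphi$, with $a\in AP$, $\triangleright\in\{\geq,>\}$, $r\in[0,1]$ ("$\geq 0$", "$>1$" forbidden). Write $\mathrm{F}_{\triangleright r}\varphi$, $\mathrm{G}_{\triangleright r}\varphi$ for $P(\mathrm{F}\varphi)\triangleright r$, $P(\mathrm{G}\varphi)\triangleright r$, and "$=1$" for "$\geq 1$". A Markov chain is $(S,P,v)$ with $S$ finite or countable, $P:S\times S\to[0,1]$ stochastic, $v:S\to 2^{AP}$; $\mathbb{P}_s$ is the probability measure on runs from $s$. Semantics: $s\models a$ iff $a\in v(s)$; $s\models\neg a$ iff $a\notin v(s)$; $\wedge,\vee$ as usual; $s\models P(\Phi)\triangleright r$ iff $\mathbb{P}_s(\{\pi:\pi\models\Phi\})\triangleright r$; $\pi\models\mathrm{F}\varphi$ iff some $\pi(i)\models\varphi$; $\pi\models\mathrm{G}\varphi$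 iff all $\pi(i)\models\varphi$. $s\models Y$ means $s$ satisfies all formulae in $Y$. $\mathit{sub}(\varphi)$: state subformulae of $\varphi$ (including $\varphi$); $\mathit{sub}(X)=\bigcup_{\varphi\in X}\mathit{sub}(\varphi)$; $\mathit{psub}(X)$: path formulae $\Phi$ with some $P(\Phi)\triangleright r\in\mathit{sub}(X)$; $\mathit{nsub}(X)$: formulae in $\mathit{sub}(X)$ not of the form $\mathrm{F}_{\triangleright r}\xi$ or $\mathrm{G}_{\triangleright r}\xi$; $b(X)=2+|\mathit{nsub}(X)|+|\mathit{psub}(X)|+\big|\bigcup_{\varphi\in X}\mathit{sub}(\varphi)\setminus\{\varphi\}\big|$. A PCTL fragment is a set of state formulae closed under state subformulae and under changes of probability constraints (if $\mathrm{F}_{\triangleright r}\varphi$, resp. $\mathrm{G}_{\triangleright r}\varphi$, is in it, so is $\mathrm{F}_{\geq r'}\varphi$, resp. $\mathrm{G}_{\geq r'}\varphi$, for every $r'$). Closure $C_s(\psi)$ (for $s\models\psi$): least $K$ with $\psi\in K$; if $\varphi_1\vee\varphi_2\in K$ and $s\models\varphi_i$ then $\varphi_i\in K$; if $\varphi_1\wedge\varphi_2\in K$ then both in $K$; if $\mathrm{F}_{\triangleright r}\varphi\in K$ and $s\models\varphi$ then $\varphi\in K$; $C_s(X)=\bigcup_{\psi\in X}C_s(\psi)$. $U_s(X)$ replaces each $P(\Phi)\triangleright r\in X$ by $P(\Phi)\geq\mathbb{P}_s(\{\pi:\pi\models\Phi\})$; $UC_s=U_s\circ C_s$. Norm: for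 $\Phi=\mathrm{F}\varphi$ or $\mathrm{G}\varphi$, $\|\Phi\|=1+\sum_{\Psi\in\mathit{psub}(\{\varphi\})}\|\Psi\|$. For finite $Y$ and state $s$: $\mathit{deg}_s(Y)$ is the set of $\mathrm{G}\varphi\in\mathit{psub}(Y)$ with $s\not\models\mathrm{G}_{=1}\varphi$; $\mathit{cf}_s(Y)$ is the set of $\mathrm{F}\varphi$ such that $Y$ contains some $\mathrm{F}_{\triangleright r}\varphi$, $s\not\models\varphi$, and there is a finite path from $s$ to a state $u$ with $u\models\varphi$ and $u\not\models\mathrm{G}_{=1}\chi$ for all $\mathrm{G}\chi\in\mathit{deg}_s(Y)$; $\|Y\|_s=1+|\mathit{deg}_s(Y)|\cdot\big(1+\sum_{\Phi\in\mathit{psub}(Y)}\|\Phi\|\big)+\sum_{\Phi\in\mathit{cf}_s(Y)}\|\Phi\|$. Progress loop for $(s,X)$: a finite sequence $L_0,\ldots,L_n$ of subsets of $\mathit{sub}(X)$ with (1) $X\subseteq L_i$ for some $i$; (2) the $L_i$ pairwise different; (3) for each $i$: if $a\in L_i$ then $\neg a\notin L_i$; if $\varphi_1\wedge\varphi_2\in L_i$ then $\varphi_1,\varphi_2\in L_i$; if $\varphi_1\vee\varphi_2\in L_i$ then $\varphi_1\in L_i$ or $\varphi_2\in L_i$; if $\mathrm{G}_{\triangleright r}\varphi\in L_i$ then $\varphi\in L_j$ for all $j$. Let $\Delta$ be the set of $\varphi\in L_0\cup\cdots\cup L_n$ that are of the form $\mathrm{G}_{\triangleright r}\chi$, or of the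 form $\mathrm{F}_{\triangleright r}\chi$ with $\chi\notin L_0\cup\cdots\cup L_n$, or of the form $\mathrm{F}_{=1}\chi$ with $\mathrm{F}_{=1}\chi\in L_i$ for some $i$ such that $\chi\notin L_i\cup\cdots\cup L_n$. Require (4) $s\models\Delta$; (5) $s\not\models\chi$ for every $\mathrm{F}_{\triangleright r}\chi\in\Delta$; (6) $\mathit{cf}_s(\Delta)\subseteq\mathit{cf}_s(X)$. A fragment $\mathcal{L}$ is progressive if for every finite set $X$ of formulae and every state $s$ of a finite Markov chain with $s\models X$, $X=UC_s(X)$ and $X\subseteq\mathcal{L}$, a progress loop for $(s,X)$ exists. *)

theory Defs
  imports "HOL-Probability.Probability"
begin

section \<open>Syntax\<close>

datatype cmp = GE | GT

datatype 'a state_fm =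
    Prop 'a
  | NProp 'a
  | And "'a state_fm" "'a state_fm"
  | Or "'a state_fm" "'a state_fm"
  | Prob "'a path_fm" cmp real
and 'a path_fm =
    Finally "'a state_fm"
  | Globally "'a state_fm"

text \<open>The grammar admits only bounds in \<open>[0,1]\<close> and excludes the constraints
  \<open>\<ge> 0\<close> and \<open>> 1\<close>.\<close>

primrec valid_bound :: "cmp \<Rightarrow> real \<Rightarrow> bool" where
  "valid_bound GE r \<longleftrightarrow> 0 < r \<and> r \<le> 1"
| "valid_bound GT r \<longleftrightarrow> 0 \<le> r \<and> r < 1"

primrec wf_state :: "'a state_fm \<Rightarrow> bool" and wf_path :: "'a path_fm \<Rightarrow> bool" where
  "wf_state (Prop a) \<longleftrightarrow> True"
| "wf_state (NProp a) \<longleftrightarrow> True"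
| "wf_state (And \<phi> \<psi>) \<longleftrightarrow> wf_state \<phi> \<and> wf_state \<psi>"
| "wf_state (Or \<phi> \<psi>) \<longleftrightarrow> wf_state \<phi> \<and> wf_state \<psi>"
| "wf_state (Prob \<Phi> c r) \<longleftrightarrow> valid_bound c r \<and> wf_path \<Phi>"
| "wf_path (Finally \<phi>) \<longleftrightarrow> wf_state \<phi>"
| "wf_path (Globally \<phi>) \<longleftrightarrow> wf_state \<phi>"

primrec sub :: "'a state_fm \<Rightarrow> 'a state_fm set" and sub_path :: "'a path_fm \<Rightarrow> 'a state_fm set" where
  "sub (Prop a) = {Prop a}"
| "sub (NProp a) = {NProp a}"
| "sub (And \<phi> \<psi>) = insert (And \<phi> \<psi>) (sub \<phi> \<union> sub \<psi>)"
| "sub (Or \<phi> \<psi>) = insert (Or \<phi> \<psi>) (sub \<phi> \<union> sub \<psi>)"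
| "sub (Prob \<Phi> c r) = insert (Prob \<Phi> c r) (sub_path \<Phi>)"
| "sub_path (Finally \<phi>) = sub \<phi>"
| "sub_path (Globally \<phi>) = sub \<phi>"

definition subs :: "'a state_fm set \<Rightarrow> 'a state_fm set" where
  "subs X = (\<Union>\<phi>\<in>X. sub \<phi>)"

definition psub :: "'a state_fm set \<Rightarrow> 'a path_fm set" where
  "psub X = {\<Phi>. \<exists>c r. Prob \<Phi> c r \<in> subs X}"

definition nsub :: "'a state_fm set \<Rightarrow> 'a state_fm set" where
  "nsub X = {\<phi> \<in> subs X. \<not> (\<exists>\<Phi> c r. \<phi> = Prob \<Phi> c r)}"

definition branching :: "'a state_fm set \<Rightarrow> nat" where
  "branching X = 2 + card (nsub X) + card (psub X) + card (\<Union>\<phi>\<in>X. sub \<phi> - {\<phi>})"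

definition pctl_fragment :: "'a state_fm set \<Rightarrow> bool" where
  "pctl_fragment \<L> \<longleftrightarrow>
     (\<forall>\<phi>\<in>\<L>. wf_state \<phi>) \<and>
     (\<forall>\<phi>\<in>\<L>. sub \<phi> \<subseteq> \<L>) \<and>
     (\<forall>\<Phi> c r r'. Prob \<Phi> c r \<in> \<L> \<longrightarrow> valid_bound GE r' \<longrightarrow> Prob \<Phi> GE r' \<in> \<L>)"

section \<open>Markov chains and semantics\<close>

text \<open>The row \<open>P(s, \<cdot>)\<close> of the stochastic matrix is the probability mass function \<open>trans M s\<close>;
  values of \<open>trans\<close> and \<open>val\<close> outside \<open>states M\<close> are irrelevant.\<close>

record ('s, 'a) markov_chain =
  states :: "'s set"
  trans :: "'s \<Rightarrow> 's pmf"
  val :: "'s \<Rightarrow> 'a set"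

definition is_markov_chain :: "('s, 'a) markov_chain \<Rightarrow> bool" where
  "is_markov_chain M \<longleftrightarrow>
     countable (states M) \<and> (\<forall>s\<in>states M. set_pmf (trans M s) \<subseteq> states M)"

text \<open>The measure on runs \<open>\<pi> :: nat \<Rightarrow> 's\<close> given by the Ionescu-Tulcea construction from the kernels
  of the chain: \<open>\<pi> 0 = s\<close> surely, and \<open>\<pi> (Suc n)\<close> is distributed according to \<open>trans M (\<pi> n)\<close>.\<close>

definition run_kernel ::
    "('s, 'a) markov_chain \<Rightarrow> 's \<Rightarrow> nat \<Rightarrow> (nat \<Rightarrow> 's) \<Rightarrow> 's measure" where
  "run_kernel M s n \<pi> =
     measure_pmf (case n of 0 \<Rightarrow> return_pmf s | Suc m \<Rightarrow> trans M (\<pi> m))"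

definition run_measure :: "('s, 'a) markov_chain \<Rightarrow> 's \<Rightarrow> (nat \<Rightarrow> 's) measure" where
  "run_measure M s = projective_family.lim UNIV
     (Ionescu_Tulcea.CI (run_kernel M s) (\<lambda>_. count_space UNIV)) (\<lambda>_. count_space UNIV)"

lemma Ionescu_Tulcea_run_kernel:
  fixes M :: "('s, 'a) markov_chain"
  shows "Ionescu_Tulcea (run_kernel M s) (\<lambda>_. count_space UNIV)"
proof (rule Ionescu_Tulcea.intro)
  fix i :: nat
  show "run_kernel M s i \<in> PiM {0..<i} (\<lambda>_. count_space UNIV) \<rightarrow>\<^sub>M subprob_algebra (count_space UNIV)"
  proof (cases i)
    case 0
    then show ?thesis
      by (auto simp: run_kernel_def[abs_def] space_subprob_algebra
          intro!: measurable_const measure_pmf.subprob_space_axioms)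
  next
    case (Suc m)
    have "(\<lambda>\<pi>. \<pi> m) \<in> PiM {0..<i} (\<lambda>_. count_space UNIV :: 's measure) \<rightarrow>\<^sub>M count_space UNIV"
      using Suc by (intro measurable_component_singleton) auto
    moreover have "(\<lambda>x. measure_pmf (trans M x)) \<in> count_space UNIV \<rightarrow>\<^sub>M subprob_algebra (count_space UNIV)"
      by (auto simp: space_subprob_algebra intro!: measure_pmf.subprob_space_axioms)
    ultimately show ?thesis
      using Suc by (auto simp: run_kernel_def[abs_def] intro: measurable_compose)
  qed
next
  fix i :: nat and \<pi> :: "nat \<Rightarrow> 's"
  show "prob_space (run_kernel M s i \<pi>)"
    by (simp add: run_kernel_def measure_pmf.prob_space_axioms)
qed

lemma sets_run_measure: "sets (run_measure M s) = sets (PiM UNIV (\<lambda>_. count_space UNIV))"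
proof -
  interpret Ionescu_Tulcea "run_kernel M s" "\<lambda>_. count_space UNIV"
    by (rule Ionescu_Tulcea_run_kernel)
  show ?thesis
    by (simp add: run_measure_def)
qed

lemma emeasure_run_measure_cylinder:
  fixes M :: "('s, 'a) markov_chain"
  shows "emeasure (run_measure M s) {\<pi>. \<forall>i\<le>n. \<pi> i = w i} =
     (if w 0 = s then \<Prod>i<n. ennreal (pmf (trans M (w i)) (w (Suc i))) else 0)"
proof -
  interpret Ionescu_Tulcea "run_kernel M s" "\<lambda>_. count_space UNIV"
    by (rule Ionescu_Tulcea_run_kernel)
  let ?N = "\<lambda>n. PiM {0..<n} (\<lambda>_. count_space UNIV :: 's measure)"
  define A where "A n = {f \<in> space (?N n). \<forall>i<n. f i = w i}" for n
  define u :: "nat \<Rightarrow> 's" where "u = (\<lambda>_. undefined)"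
  have A_sets [measurable]: "A n \<in> sets (?N n)" for n
  proof -
    have "A n = space (?N n) \<inter> (\<Inter>i\<in>{0..<n}. {f \<in> space (?N n). f i = w i})"
      by (auto simp: A_def)
    also have "\<dots> \<in> sets (?N n)"
    proof (cases "n = 0")
      case False
      have "{f \<in> space (?N n). f i = w i} \<in> sets (?N n)" if "i \<in> {0..<n}" for i
        using measurable_sets[OF measurable_component_singleton[OF that], of "{w i}" "\<lambda>_. count_space UNIV"]
        by (auto simp: vimage_def Int_def conj_commute)
      then show ?thesis
        using False by (intro sets.Int sets.finite_INT) auto
    qed auto
    finally show ?thesis .
  qed
  have u: "u \<in> space (?N 0)"
    by (auto simp: u_def space_PiM)
  have step: "emeasure (C 0 (Suc n) u) (A (Suc n)) =
     emeasure (C 0 n u) (A n) * emeasure (run_kernel M s n w) {w n}" for n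
  proof -
    have sC: "sets (C 0 n u) = sets (?N n)" "space (C 0 n u) = space (?N n)"
      using sets_C[OF u, of n] space_C[OF u, of n] by simp_all
    have eP: "eP n \<in> C 0 n u \<rightarrow>\<^sub>M subprob_algebra (?N (Suc n))"
      unfolding measurable_cong_sets[OF sC(1) refl] by (rule measurable_eP)
    have "emeasure (C 0 (Suc n) u) (A (Suc n)) = (\<integral>\<^sup>+x. emeasure (eP n x) (A (Suc n)) \<partial>C 0 n u)"
      using u sC eP by (auto intro!: emeasure_bind[where N="?N (Suc n)"] simp: space_PiM PiE_eq_empty_iff)
    also have "\<dots> = (\<integral>\<^sup>+x. emeasure (run_kernel M s n w) {w n} * indicator (A n) x \<partial>C 0 n u)"
    proof (rule nn_integral_cong)
      fix x assume "x \<in> space (C 0 n u)"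
      then have x: "x \<in> space (?N n)" by (simp add: sC)
      have eq: "fun_upd x n -` A (Suc n) = (if x \<in> A n then {w n} else {})"
        using x by (auto simp: A_def space_PiM PiE_iff extensional_def less_Suc_eq)
      have "run_kernel M s n x = run_kernel M s n w" if "x \<in> A n"
        using that by (auto simp: run_kernel_def A_def split: nat.split)
      then show "emeasure (eP n x) (A (Suc n)) = emeasure (run_kernel M s n w) {w n} * indicator (A n) x"
        by (subst emeasure_eP[OF x A_sets]) (auto simp: eq)
    qed
    also have "\<dots> = emeasure (run_kernel M s n w) {w n} * emeasure (C 0 n u) (A n)"
      by (rule nn_integral_cmult_indicator) (simp add: sC)
    finally show ?thesis by (simp add: mult.commute)
  qed
  have C_A: "emeasure (C 0 (Suc n) u) (A (Suc n)) =
     (if w 0 = s then \<Prod>i<n. ennreal (pmf (trans M (w i)) (w (Suc i))) else 0)" for n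
  proof (induction n)
    case 0
    have "emeasure (C 0 0 u) (A 0) = 1"
      using u by (auto simp: A_def)
    then show ?case
      by (subst step) (auto simp: run_kernel_def emeasure_pmf_single pmf_return indicator_def)
  next
    case (Suc n)
    show ?case
      by (subst step, subst Suc.IH) (auto simp: run_kernel_def emeasure_pmf_single)
  qed
  have "{\<pi>. \<forall>i\<le>n. \<pi> i = w i} = PF.emb UNIV {0..<Suc n} (A (Suc n))"
    by (auto simp: prod_emb_def A_def space_PiM less_Suc_eq_le)
  then have "emeasure (run_measure M s) {\<pi>. \<forall>i\<le>n. \<pi> i = w i} = emeasure (CI {0..<Suc n}) (A (Suc n))"
    unfolding run_measure_def by (simp only:) (rule lim, simp_all)
  also have "\<dots> = emeasure (C 0 (Suc n) u) (PF.emb {0..<Suc n} {0..<Suc n} (A (Suc n)))"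
    unfolding u_def by (rule emeasure_CI) simp_all
  also have "PF.emb {0..<Suc n} {0..<Suc n} (A (Suc n)) = A (Suc n)"
    by (rule prod_emb_id) (auto simp: A_def space_PiM)
  finally show ?thesis by (simp only: C_A)
qed

primrec holds :: "cmp \<Rightarrow> real \<Rightarrow> real \<Rightarrow> bool" where
  "holds GE p r \<longleftrightarrow> p \<ge> r"
| "holds GT p r \<longleftrightarrow> p > r"

primrec sat :: "('s, 'a) markov_chain \<Rightarrow> 'a state_fm \<Rightarrow> 's \<Rightarrow> bool"
    and sat_path :: "('s, 'a) markov_chain \<Rightarrow> 'a path_fm \<Rightarrow> (nat \<Rightarrow> 's) \<Rightarrow> bool" where
  "sat M (Prop a) s \<longleftrightarrow> a \<in> val M s"
| "sat M (NProp a) s \<longleftrightarrow> a \<notin> val M s"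
| "sat M (And \<phi> \<psi>) s \<longleftrightarrow> sat M \<phi> s \<and> sat M \<psi> s"
| "sat M (Or \<phi> \<psi>) s \<longleftrightarrow> sat M \<phi> s \<or> sat M \<psi> s"
| "sat M (Prob \<Phi> c r) s \<longleftrightarrow> holds c (measure (run_measure M s) {\<pi>. sat_path M \<Phi> \<pi>}) r"
| "sat_path M (Finally \<phi>) \<pi> \<longleftrightarrow> (\<exists>i. sat M \<phi> (\<pi> i))"
| "sat_path M (Globally \<phi>) \<pi> \<longleftrightarrow> (\<forall>i. sat M \<phi> (\<pi> i))"

definition path_prob :: "('s, 'a) markov_chain \<Rightarrow> 's \<Rightarrow> 'a path_fm \<Rightarrow> real" where
  "path_prob M s \<Phi> = measure (run_measure M s) {\<pi>. sat_path M \<Phi> \<pi>}"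

definition reachable :: "('s, 'a) markov_chain \<Rightarrow> 's \<Rightarrow> 's \<Rightarrow> bool" where
  "reachable M s u \<longleftrightarrow> (s, u) \<in> {(x, y). pmf (trans M x) y > 0}\<^sup>*"

section \<open>Closure and update\<close>

inductive_set closure_fm :: "('s, 'a) markov_chain \<Rightarrow> 's \<Rightarrow> 'a state_fm \<Rightarrow> 'a state_fm set"
  for M :: "('s, 'a) markov_chain" and s :: 's and \<psi> :: "'a state_fm" where
  base: "\<psi> \<in> closure_fm M s \<psi>"
| or1: "Or \<phi>1 \<phi>2 \<in> closure_fm M s \<psi> \<Longrightarrow> sat M \<phi>1 s \<Longrightarrow> \<phi>1 \<in> closure_fm M s \<psi>"
| or2: "Or \<phi>1 \<phi>2 \<in> closure_fm M s \<psi> \<Longrightarrow> sat M \<phi>2 s \<Longrightarrow> \<phi>2 \<in> closure_fm M s \<psi>"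
| and1: "And \<phi>1 \<phi>2 \<in> closure_fm M s \<psi> \<Longrightarrow> \<phi>1 \<in> closure_fm M s \<psi>"
| and2: "And \<phi>1 \<phi>2 \<in> closure_fm M s \<psi> \<Longrightarrow> \<phi>2 \<in> closure_fm M s \<psi>"
| future: "Prob (Finally \<phi>) c r \<in> closure_fm M s \<psi> \<Longrightarrow> sat M \<phi> s \<Longrightarrow> \<phi> \<in> closure_fm M s \<psi>"

definition closure_set :: "('s, 'a) markov_chain \<Rightarrow> 's \<Rightarrow> 'a state_fm set \<Rightarrow> 'a state_fm set" where
  "closure_set M s X = (\<Union>\<psi>\<in>X. closure_fm M s \<psi>)"

fun update_fm :: "('s, 'a) markov_chain \<Rightarrow> 's \<Rightarrow> 'a state_fm \<Rightarrow> 'a state_fm" where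
  "update_fm M s (Prob \<Phi> c r) = Prob \<Phi> GE (path_prob M s \<Phi>)"
| "update_fm M s \<phi> = \<phi>"

definition update_set :: "('s, 'a) markov_chain \<Rightarrow> 's \<Rightarrow> 'a state_fm set \<Rightarrow> 'a state_fm set" where
  "update_set M s X = update_fm M s ` X"

definition UC :: "('s, 'a) markov_chain \<Rightarrow> 's \<Rightarrow> 'a state_fm set \<Rightarrow> 'a state_fm set" where
  "UC M s X = update_set M s (closure_set M s X)"

section \<open>Norms\<close>

lemma sub_size:
  fixes \<phi> \<xi> :: "'a state_fm" and \<Phi> :: "'a path_fm"
  shows "\<xi> \<in> sub \<phi> \<Longrightarrow> size \<xi> \<le> size \<phi>" and "\<xi> \<in> sub_path \<Phi> \<Longrightarrow> size \<xi> < size \<Phi>"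
  by (induction \<phi> and \<Phi>) auto

lemma psub_size: "\<Psi> \<in> psub {\<phi>} \<Longrightarrow> size \<Psi> < size \<phi>"
  by (auto simp: psub_def subs_def dest!: sub_size(1))

function path_norm :: "'a path_fm \<Rightarrow> nat" where
  "path_norm (Finally \<phi>) = 1 + (\<Sum>\<Psi>\<in>psub {\<phi>}. path_norm \<Psi>)"
| "path_norm (Globally \<phi>) = 1 + (\<Sum>\<Psi>\<in>psub {\<phi>}. path_norm \<Psi>)"
  by pat_completeness auto
termination
  by (relation "Wellfounded.measure size") (auto dest: psub_size)

definition deg :: "('s, 'a) markov_chain \<Rightarrow> 's \<Rightarrow> 'a state_fm set \<Rightarrow> 'a path_fm set" where
  "deg M s Y = {Globally \<phi> |\<phi>. Globally \<phi> \<in> psub Y \<and> \<not> sat M (Prob (Globally \<phi>) GE 1) s}"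

definition cf :: "('s, 'a) markov_chain \<Rightarrow> 's \<Rightarrow> 'a state_fm set \<Rightarrow> 'a path_fm set" where
  "cf M s Y = {Finally \<phi> |\<phi>.
     (\<exists>c r. Prob (Finally \<phi>) c r \<in> Y) \<and> \<not> sat M \<phi> s \<and>
     (\<exists>u. reachable M s u \<and> sat M \<phi> u \<and>
        (\<forall>\<xi>. Globally \<xi> \<in> deg M s Y \<longrightarrow> \<not> sat M (Prob (Globally \<xi>) GE 1) u))}"

definition set_norm :: "('s, 'a) markov_chain \<Rightarrow> 's \<Rightarrow> 'a state_fm set \<Rightarrow> nat" where
  "set_norm M s Y =
     1 + card (deg M s Y) * (1 + (\<Sum>\<Phi>\<in>psub Y. path_norm \<Phi>)) + (\<Sum>\<Phi>\<in>cf M s Y. path_norm \<Phi>)"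

section \<open>Progress loops\<close>

definition loop_delta :: "nat \<Rightarrow> (nat \<Rightarrow> 'a state_fm set) \<Rightarrow> 'a state_fm set" where
  "loop_delta n L = {\<phi> \<in> (\<Union>i\<le>n. L i).
     (\<exists>\<xi> c r. \<phi> = Prob (Globally \<xi>) c r) \<or>
     (\<exists>\<xi> c r. \<phi> = Prob (Finally \<xi>) c r \<and> \<xi> \<notin> (\<Union>i\<le>n. L i)) \<or>
     (\<exists>\<xi>. \<phi> = Prob (Finally \<xi>) GE 1 \<and> (\<exists>i\<le>n. \<phi> \<in> L i \<and> \<xi> \<notin> (\<Union>j\<in>{i..n}. L j)))}"

text \<open>The loop is the finite sequence \<open>L 0, \<dots>, L n\<close>; values of \<open>L\<close> beyond \<open>n\<close> are irrelevant.\<close>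

definition progress_loop :: "('s, 'a) markov_chain \<Rightarrow> 's \<Rightarrow> 'a state_fm set \<Rightarrow>
    nat \<Rightarrow> (nat \<Rightarrow> 'a state_fm set) \<Rightarrow> bool" where
  "progress_loop M s X n L \<longleftrightarrow>
     (\<forall>i\<le>n. L i \<subseteq> subs X) \<and>
     (\<exists>i\<le>n. X \<subseteq> L i) \<and>
     inj_on L {..n} \<and>
     (\<forall>i\<le>n.
        (\<forall>a. Prop a \<in> L i \<longrightarrow> NProp a \<notin> L i) \<and>
        (\<forall>\<phi>1 \<phi>2. And \<phi>1 \<phi>2 \<in> L i \<longrightarrow> \<phi>1 \<in> L i \<and> \<phi>2 \<in> L i) \<and>
        (\<forall>\<phi>1 \<phi>2. Or \<phi>1 \<phi>2 \<in> L i \<longrightarrow> \<phi>1 \<in> L i \<or> \<phi>2 \<in> L i) \<and>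
        (\<forall>\<phi> c r. Prob (Globally \<phi>) c r \<in> L i \<longrightarrow> (\<forall>j\<le>n. \<phi> \<in> L j))) \<and>
     (\<forall>\<phi>\<in>loop_delta n L. sat M \<phi> s) \<and>
     (\<forall>\<xi> c r. Prob (Finally \<xi>) c r \<in> loop_delta n L \<longrightarrow> \<not> sat M \<xi> s) \<and>
     cf M s (loop_delta n L) \<subseteq> cf M s X"

text \<open>Every finite Markov chain is isomorphic to one whose states are natural numbers, so
  quantifying over chains with states in \<open>nat\<close> covers all finite chains.\<close>

definition progressive :: "'a state_fm set \<Rightarrow> bool" where
  "progressive \<L> \<longleftrightarrow>
     (\<forall>(M :: (nat, 'a) markov_chain) s X.
        is_markov_chain M \<and> finite (states M) \<and> s \<in> states M \<and>
        finite X \<and> X \<subseteq> \<L> \<and> (\<forall>\<phi>\<in>X. sat M \<phi> s) \<and> X = UC M s X \<longrightarrow>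
        (\<exists>n L. progress_loop M s X n L))"

end

theory Submission
  imports Defs
begin

text \<open>
  The model is built by induction on \<open>\<parallel>X\<parallel>\<^sub>s\<close>. A progress loop \<open>L\<^sub>0, \<dots>, L\<^sub>n\<close> for \<open>(s, X)\<close> becomes a cycle of
  states which the last one leaves with a small probability \<open>\<epsilon>\<close>. Formulae outside \<open>\<Delta>\<close> are satisfied by
  going round the cycle; those of \<open>\<Delta>\<close> have to be satisfied after the exit.

  Run the given chain from \<open>s\<close> until it reaches a state \<open>t\<close> in which either some \<open>G \<xi> \<in> deg\<^sub>s(X)\<close> has
  probability one, or \<open>\<phi>\<close> holds for some \<open>F \<phi>\<close> in \<open>\<Delta>\<close>. By the maximum principle, runs that never stop
  contribute nothing to the probabilities of the eventualities and of the degenerate \<open>G\<close>-formulae in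
  \<open>\<Delta>\<close>, so the conditional distribution of \<open>t\<close> is a good exit distribution, and by Caratheodory's theorem
  it can be replaced by one supported on few states. At each such \<open>t\<close> the residual obligations have a
  smaller norm: \<open>deg\<close> shrinks, or \<open>F \<phi> \<in> cf\<^sub>s(X)\<close> is replaced by the path formulae inside \<open>\<phi>\<close>. If the run
  never stops, \<open>\<Delta>\<close> contains only \<open>G\<close>-formulae of probability one, and the cycle needs no exit.
\<close>

subsection \<open>Reachability probabilities in finite chains\<close>

text \<open>Finite-horizon version of \<open>stay\<close>, given by a one-step recursion. Passing to
  its limit lets later arguments use induction on the horizon instead of shifts of the run
  measure.\<close>

primrec stay_upto :: "('s, 'a) markov_chain \<Rightarrow> 's set \<Rightarrow> nat \<Rightarrow> 's \<Rightarrow> real" where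
  "stay_upto M A 0 u = indicator A u"
| "stay_upto M A (Suc n) u =
     indicator A u * measure_pmf.expectation (trans M u) (stay_upto M A n)"

definition stay :: "('s, 'a) markov_chain \<Rightarrow> 's set \<Rightarrow> 's \<Rightarrow> real" where
  "stay M A u = measure (run_measure M u) {\<pi>. \<forall>i. \<pi> i \<in> A}"

section \<open>Total mass and measurable sets of the run measure\<close>

text \<open>The projection of the limit to the empty index set is a finite-dimensional marginal,
  hence a probability measure; a measure whose image is a probability measure is itself one.\<close>

lemma prob_space_run_measure: "prob_space (run_measure M s)"
proof -
  interpret Ionescu_Tulcea "run_kernel M s" "\<lambda>_. count_space UNIV"
    by (rule Ionescu_Tulcea_run_kernel)
  have "prob_space (distr PF.lim (PiM {} (\<lambda>_. count_space UNIV)) (\<lambda>x. restrict x {}))"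
    unfolding distr_lim[OF finite.emptyI] by (rule PF.prob_space_P) simp_all
  then show ?thesis
    unfolding run_measure_def
    by (rule prob_space_distrD[rotated])
      (simp add: measurable_cong_sets[OF PF.sets_lim] measurable_restrict_subset)
qed

lemma space_run_measure [simp]: "space (run_measure M s) = UNIV"
  using sets_eq_imp_space_eq[OF sets_run_measure[of M s]] by (simp add: space_PiM PiE_def)

lemma coordinate_sets [measurable]: "{\<pi>. \<pi> i \<in> A} \<in> sets (run_measure M s)"
proof -
  have "(\<lambda>\<pi>. \<pi> i) \<in> PiM UNIV (\<lambda>_. count_space UNIV :: 'a measure) \<rightarrow>\<^sub>M count_space UNIV"
    by (intro measurable_component_singleton) auto
  from measurable_sets[OF this, of A] show ?thesis
    by (simp add: sets_run_measure vimage_def space_PiM PiE_def)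
qed

lemma run_sets_All_nat: "(\<And>i :: nat. {\<pi>. P i \<pi>} \<in> sets (run_measure M s)) \<Longrightarrow>
    {\<pi>. \<forall>i. P i \<pi>} \<in> sets (run_measure M s)"
proof -
  assume *: "\<And>i :: nat. {\<pi>. P i \<pi>} \<in> sets (run_measure M s)"
  have "{\<pi>. \<forall>i. P i \<pi>} = (\<Inter>i. {\<pi>. P i \<pi>})" by auto
  then show ?thesis using * by auto
qed

lemma run_sets_impl: "(Q \<Longrightarrow> {\<pi>. P \<pi>} \<in> sets (run_measure M s)) \<Longrightarrow>
    {\<pi>. Q \<longrightarrow> P \<pi>} \<in> sets (run_measure M s)"
  using sets.top[of "run_measure M s"] by (cases Q) simp_all

lemma run_sets_conj: "{\<pi>. P \<pi>} \<in> sets (run_measure M s) \<Longrightarrow> {\<pi>. Q \<pi>} \<in> sets (run_measure M s) \<Longrightarrow>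
    {\<pi>. P \<pi> \<and> Q \<pi>} \<in> sets (run_measure M s)"
  using sets.Int[of "{\<pi>. P \<pi>}" "run_measure M s" "{\<pi>. Q \<pi>}"] by (simp add: Int_def)

lemma coordinate_eq_sets: "{\<pi>. \<pi> i = x} \<in> sets (run_measure M s)"
  using coordinate_sets[of i "{x}" M s] by simp

lemmas run_sets = run_sets_All_nat run_sets_impl run_sets_conj coordinate_sets coordinate_eq_sets

lemma stay_le_1 [simp]: "stay M A u \<le> 1"
  unfolding stay_def by (rule prob_space.prob_le_1[OF prob_space_run_measure])

lemma path_prob_nonneg [simp]: "0 \<le> path_prob M u \<Phi>"
  by (simp add: path_prob_def)

lemma path_prob_le_1 [simp]: "path_prob M u \<Phi> \<le> 1"
  unfolding path_prob_def by (rule prob_space.prob_le_1[OF prob_space_run_measure])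

lemma path_prob_Globally: "path_prob M u (Globally \<phi>) = stay M {v. sat M \<phi> v} u"
  by (simp add: path_prob_def stay_def)

text \<open>Complementing the event expresses eventualities by \<open>stay\<close> too, so
  \<open>stay\<close> is the only quantity whose recursion and limit have to be studied.\<close>

lemma path_prob_Finally: "path_prob M u (Finally \<phi>) = 1 - stay M {v. \<not> sat M \<phi> v} u"
proof -
  interpret prob_space "run_measure M u" by (rule prob_space_run_measure)
  have "{\<pi>. \<forall>i. \<pi> i \<in> {v. \<not> sat M \<phi> v}} \<in> events"
    by (intro run_sets)
  note prob_compl[OF this]
  moreover have "{\<pi>. \<exists>i. sat M \<phi> (\<pi> i)} = space (run_measure M u) - {\<pi>. \<forall>i. \<pi> i \<in> {v. \<not> sat M \<phi> v}}"
    by auto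
  ultimately show ?thesis
    by (simp add: path_prob_def stay_def)
qed

lemma sat_Prob_iff: "sat M (Prob \<Phi> c r) u \<longleftrightarrow> holds c (path_prob M u \<Phi>) r"
  by (simp add: path_prob_def)

section \<open>One-step recursion and greatest fixed point for \<open>stay\<close>\<close>

locale finite_chain =
  fixes M :: "('s, 'a) markov_chain"
  assumes chain: "is_markov_chain M" and fin: "finite (states M)"
begin

abbreviation S :: "'s set" where "S \<equiv> states M"

abbreviation E :: "'s \<Rightarrow> ('s \<Rightarrow> real) \<Rightarrow> real" where
  "E u \<equiv> measure_pmf.expectation (trans M u)"

lemma succ_closed: "u \<in> S \<Longrightarrow> set_pmf (trans M u) \<subseteq> S"
  using chain by (auto simp: is_markov_chain_def)

lemma E_sum: "u \<in> S \<Longrightarrow> E u h = (\<Sum>v\<in>S. pmf (trans M u) v * h v)"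
  using integral_measure_pmf[OF fin, of "trans M u" h] succ_closed[of u] by auto

lemma sum_pmf: "u \<in> S \<Longrightarrow> (\<Sum>v\<in>S. pmf (trans M u) v) = 1"
  using sum_pmf_eq_1[OF fin succ_closed] by auto

lemma E_mono: "u \<in> S \<Longrightarrow> (\<And>v. v \<in> S \<Longrightarrow> h v \<le> h' v) \<Longrightarrow> E u h \<le> E u h'"
  by (simp add: E_sum mult_left_mono sum_mono)

lemma E_cong: "u \<in> S \<Longrightarrow> (\<And>v. v \<in> S \<Longrightarrow> h v = h' v) \<Longrightarrow> E u h = E u h'"
  by (simp add: E_sum)

lemma stay_upto_nonneg: "0 \<le> stay_upto M A n u"
  by (induction n arbitrary: u) (auto intro!: mult_nonneg_nonneg)

lemma stay_upto_UNIV: "u \<in> S \<Longrightarrow> stay_upto M UNIV n u = 1"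
proof (induction n arbitrary: u)
  case (Suc n)
  then show ?case
    by (simp add: E_sum sum_pmf)
qed simp

text \<open>A form of the Markov property, obtained from cylinder measures alone: after a fixed
  prefix \<open>w\<close> the future depends only on \<open>w m\<close>. Restricting to
  \<open>S\<close> makes the split by the state at time \<open>m + 1\<close> a finite sum.\<close>

lemma emeasure_prefix_stay:
  assumes "w m \<in> S"
  shows "emeasure (run_measure M s)
      {\<pi>. (\<forall>i\<le>m. \<pi> i = w i) \<and> (\<forall>i. m \<le> i \<longrightarrow> i \<le> m + n \<longrightarrow> \<pi> i \<in> A \<inter> S)} =
    emeasure (run_measure M s) {\<pi>. \<forall>i\<le>m. \<pi> i = w i} * ennreal (stay_upto M A n (w m))"
  using assms
proof (induction n arbitrary: m w)
  case 0
  have "{\<pi>. (\<forall>i\<le>m. \<pi> i = w i) \<and> (\<forall>i. m \<le> i \<longrightarrow> i \<le> m + 0 \<longrightarrow> \<pi> i \<in> A \<inter> S)} =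
     (if w m \<in> A then {\<pi>. \<forall>i\<le>m. \<pi> i = w i} else {})"
    using 0 by (auto dest: le_antisym)
  then show ?case by simp
next
  case (Suc n)
  let ?\<mu> = "emeasure (run_measure M s)"
  show ?case
  proof (cases "w m \<in> A")
    case False
    then have "{\<pi>. (\<forall>i\<le>m. \<pi> i = w i) \<and> (\<forall>i. m \<le> i \<longrightarrow> i \<le> m + Suc n \<longrightarrow> \<pi> i \<in> A \<inter> S)} = {}"
      by auto
    then show ?thesis by (simp only: emeasure_empty) (use False in simp)
  next
    case True
    \<comment> \<open>\<open>v x\<close> extends the prefix by \<open>x\<close> at position
      \<open>m + 1\<close>, so \<open>B x\<close> again has the form covered by the induction
      hypothesis, with horizon \<open>n\<close>.\<close>
    define v where "v x = w(Suc m := x)" for x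
    define B where "B x = {\<pi>. (\<forall>i\<le>Suc m. \<pi> i = v x i) \<and>
       (\<forall>i. Suc m \<le> i \<longrightarrow> i \<le> Suc m + n \<longrightarrow> \<pi> i \<in> A \<inter> S)}" for x
    have B_sets: "B x \<in> sets (run_measure M s)" for x
      unfolding B_def by (intro run_sets)
    have "{\<pi>. (\<forall>i\<le>m. \<pi> i = w i) \<and> (\<forall>i. m \<le> i \<longrightarrow> i \<le> m + Suc n \<longrightarrow> \<pi> i \<in> A \<inter> S)} = (\<Union>x\<in>S. B x)"
      (is "?L = ?R")
    proof (intro set_eqI iffI)
      fix \<pi> assume "\<pi> \<in> ?L"
      then have 1: "\<And>i. i \<le> m \<Longrightarrow> \<pi> i = w i"
        and 2: "\<And>i. m \<le> i \<Longrightarrow> i \<le> m + Suc n \<Longrightarrow> \<pi> i \<in> A \<inter> S"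
        by blast+
      have "\<pi> i = v (\<pi> (Suc m)) i" if "i \<le> Suc m" for i
        using that 1 by (cases "i = Suc m") (auto simp: v_def)
      then have "\<pi> \<in> B (\<pi> (Suc m))"
        unfolding B_def using 2 by (intro CollectI conjI allI impI) (blast, simp)
      moreover have "\<pi> (Suc m) \<in> S"
        using 2[of "Suc m"] by simp
      ultimately show "\<pi> \<in> ?R" by blast
    next
      fix \<pi> assume "\<pi> \<in> ?R"
      then obtain x where x: "\<pi> \<in> B x" by auto
      then have 1: "\<pi> i = w i" if "i \<le> m" for i
        using that by (auto simp: B_def v_def)
      have "\<pi> i \<in> A \<inter> S" if "m \<le> i" "i \<le> m + Suc n" for i
      proof (cases "i = m")
        case True
        with 1[of m] \<open>w m \<in> A\<close> Suc.prems show ?thesis by simp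
      next
        case False
        with that x show ?thesis by (auto simp: B_def)
      qed
      with 1 show "\<pi> \<in> ?L" by auto
    qed
    then have "?\<mu> {\<pi>. (\<forall>i\<le>m. \<pi> i = w i) \<and> (\<forall>i. m \<le> i \<longrightarrow> i \<le> m + Suc n \<longrightarrow> \<pi> i \<in> A \<inter> S)} = ?\<mu> (\<Union>x\<in>S. B x)"
      by simp
    also have "\<dots> = (\<Sum>x\<in>S. ?\<mu> (B x))"
    proof (rule sum_emeasure[symmetric])
      show "disjoint_family_on B S"
        by (auto simp: disjoint_family_on_def B_def v_def)
    qed (use B_sets fin in auto)
    also have "\<dots> = (\<Sum>x\<in>S. ?\<mu> {\<pi>. \<forall>i\<le>m. \<pi> i = w i} *
        ennreal (pmf (trans M (w m)) x * stay_upto M A n x))"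
    proof (rule sum.cong[OF refl])
      fix x assume x: "x \<in> S"
      have "?\<mu> (B x) = ?\<mu> {\<pi>. \<forall>i\<le>Suc m. \<pi> i = v x i} * ennreal (stay_upto M A n (v x (Suc m)))"
        unfolding B_def by (rule Suc.IH) (simp add: v_def x)
      also have "?\<mu> {\<pi>. \<forall>i\<le>Suc m. \<pi> i = v x i} =
          ?\<mu> {\<pi>. \<forall>i\<le>m. \<pi> i = w i} * ennreal (pmf (trans M (w m)) x)"
        unfolding emeasure_run_measure_cylinder by (auto simp: v_def)
      finally show "?\<mu> (B x) = ?\<mu> {\<pi>. \<forall>i\<le>m. \<pi> i = w i} *
        ennreal (pmf (trans M (w m)) x * stay_upto M A n x)"
        by (simp add: v_def ennreal_mult' mult.assoc stay_upto_nonneg)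
    qed
    also have "\<dots> = ?\<mu> {\<pi>. \<forall>i\<le>m. \<pi> i = w i} *
        ennreal (\<Sum>x\<in>S. pmf (trans M (w m)) x * stay_upto M A n x)"
      by (simp add: sum_distrib_left[symmetric] stay_upto_nonneg sum_ennreal)
    finally show ?thesis
      using True Suc.prems by (simp add: E_sum)
  qed
qed

text \<open>Continuity from above along a decreasing sequence of events. The events used carry the
  extra requirement of starting in \<open>u\<close> and remaining in \<open>S\<close>.\<close>

lemma stay_upto_tendsto:
  assumes u: "u \<in> S"
  shows "(\<lambda>n. stay_upto M A n u) \<longlonglongrightarrow> stay M A u"
proof -
  interpret prob_space "run_measure M u" by (rule prob_space_run_measure)
  define F where "F A n = {\<pi>. \<pi> 0 = u \<and> (\<forall>i. i \<le> n \<longrightarrow> \<pi> i \<in> A \<inter> S)}" for A and n :: nat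
  define G where "G A = {\<pi>. \<pi> 0 = u \<and> (\<forall>i :: nat. \<pi> i \<in> A \<inter> S)}" for A
  have F_sets: "F A n \<in> events" for A n
    unfolding F_def by (intro run_sets)
  have G_sets: "G A \<in> events" for A
    unfolding G_def by (intro run_sets)
  have "{\<pi> :: nat \<Rightarrow> 's. \<pi> 0 = u} = {\<pi>. \<forall>i\<le>0. \<pi> i = (\<lambda>_. u) i}" by auto
  then have "emeasure (run_measure M u) {\<pi>. \<pi> 0 = u} = 1"
    by (simp only: emeasure_run_measure_cylinder) simp
  then have "prob (F A n) = stay_upto M A n u" for A n
    using emeasure_prefix_stay[of "\<lambda>_. u" 0 u n A] u
    by (simp add: F_def measure_def stay_upto_nonneg)
  moreover have "(\<lambda>n. prob (F A n)) \<longlonglongrightarrow> prob (\<Inter>n. F A n)" for A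
    by (rule finite_Lim_measure_decseq) (use F_sets in \<open>auto simp: F_def decseq_def\<close>)
  moreover have "(\<Inter>n. F A n) = G A" for A
    by (auto simp: F_def G_def)
  ultimately have lim: "(\<lambda>n. stay_upto M A n u) \<longlonglongrightarrow> prob (G A)" for A
    by simp
  have "prob (G UNIV) = 1"
    using lim[of UNIV] u by (simp add: stay_upto_UNIV LIMSEQ_const_iff)
  then have AE: "AE \<pi> in run_measure M u. \<pi> \<in> G UNIV"
    using prob_eq_1[OF G_sets] by simp
  have "prob (G A) = stay M A u"
    unfolding stay_def
  proof (rule finite_measure_eq_AE)
    show "AE \<pi> in run_measure M u. \<pi> \<in> G A \<longleftrightarrow> \<pi> \<in> {\<pi>. \<forall>i. \<pi> i \<in> A}"
      using AE by (rule eventually_mono) (auto simp: G_def)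
  qed (auto intro!: run_sets G_sets)
  with lim[of A] show ?thesis by simp
qed

lemma stay_step:
  assumes u: "u \<in> S"
  shows "stay M A u = indicator A u * E u (stay M A)"
proof (rule LIMSEQ_unique)
  show "(\<lambda>n. stay_upto M A (Suc n) u) \<longlonglongrightarrow> stay M A u"
    using stay_upto_tendsto[OF u] by (rule LIMSEQ_Suc)
  show "(\<lambda>n. stay_upto M A (Suc n) u) \<longlonglongrightarrow> indicator A u * E u (stay M A)"
    using u by (auto simp: E_sum intro!: tendsto_intros stay_upto_tendsto)
qed

text \<open>Among functions bounded by 1, \<open>stay M A\<close> is the greatest post-fixed point
  of its one-step operator: any such \<open>h\<close> lies below every
  \<open>stay_upto M A n\<close>, by induction on \<open>n\<close>.\<close>

lemma stay_greatest:
  assumes le_1: "\<And>u. u \<in> S \<Longrightarrow> h u \<le> 1"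
    and post: "\<And>u. u \<in> S \<Longrightarrow> h u \<le> indicator A u * E u h"
    and u: "u \<in> S"
  shows "h u \<le> stay M A u"
proof (rule LIMSEQ_le_const[OF stay_upto_tendsto[OF u]])
  have "h u \<le> stay_upto M A n u" if "u \<in> S" for n u
    using that
  proof (induction n arbitrary: u)
    case 0
    then show ?case using le_1[of u] post[of u] by (auto simp: indicator_def)
  next
    case (Suc n)
    have "h u \<le> indicator A u * E u h" by (rule post) fact
    also have "\<dots> \<le> stay_upto M A (Suc n) u"
      using Suc by (auto intro!: mult_left_mono E_mono)
    finally show ?case .
  qed
  then show "\<exists>N. \<forall>n\<ge>N. h u \<le> stay_upto M A n u" using u by auto
qed

lemma path_prob_Finally_step:
  assumes u: "u \<in> S"
  shows "path_prob M u (Finally \<phi>) =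
    (if sat M \<phi> u then 1 else E u (\<lambda>v. path_prob M v (Finally \<phi>)))"
  unfolding path_prob_Finally
  by (subst stay_step[OF u]) (simp add: E_sum u right_diff_distrib sum_subtractf sum_pmf)

lemma path_prob_Globally_step:
  assumes u: "u \<in> S"
  shows "path_prob M u (Globally \<phi>) =
    (if sat M \<phi> u then E u (\<lambda>v. path_prob M v (Globally \<phi>)) else 0)"
  unfolding path_prob_Globally
  by (subst stay_step[OF u]) simp

end

section \<open>Invariance under morphisms of chains\<close>

context
  fixes N :: "('s, 'a) markov_chain" and N' :: "('t, 'a) markov_chain" and f :: "'s \<Rightarrow> 't"
  assumes N: "finite_chain N" and N': "finite_chain N'"
    and f_states: "f ` states N \<subseteq> states N'"
    and f_trans: "\<And>u. u \<in> states N \<Longrightarrow> trans N' (f u) = map_pmf f (trans N u)"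
    and f_val: "\<And>u. u \<in> states N \<Longrightarrow> val N' (f u) = val N u"
begin

text \<open>An expectation over \<open>map_pmf f\<close> is an expectation of the composition with
  \<open>f\<close>, so the finite-horizon values agree by induction, and then their limits
  do.\<close>

lemma stay_morphism:
  assumes A: "\<And>u. u \<in> states N \<Longrightarrow> f u \<in> A' \<longleftrightarrow> u \<in> A" and u: "u \<in> states N"
  shows "stay N' A' (f u) = stay N A u"
proof -
  interpret N: finite_chain N by (rule N)
  interpret N': finite_chain N' by (rule N')
  have "stay_upto N' A' n (f u) = stay_upto N A n u" if "u \<in> states N" for n u
    using that
  proof (induction n arbitrary: u)
    case 0
    then show ?case using A by (simp add: indicator_def)
  next
    case (Suc n)
    have "N.E u (\<lambda>v. stay_upto N' A' n (f v)) = N.E u (stay_upto N A n)"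
      using Suc by (intro N.E_cong) auto
    then show ?case
      using Suc A by (simp add: f_trans integral_map_pmf indicator_def)
  qed
  then have "(\<lambda>n. stay_upto N' A' n (f u)) = (\<lambda>n. stay_upto N A n u)"
    using u by auto
  moreover have "f u \<in> states N'" using f_states u by auto
  ultimately show ?thesis
    using N.stay_upto_tendsto[OF u, of A] N'.stay_upto_tendsto[of "f u" A'] LIMSEQ_unique by auto
qed

text \<open>The path half of the mutual induction speaks of probabilities, not of single runs: this
  is what the \<open>Prob\<close> case consumes, and no run measure has to be transported along
  \<open>f\<close>.\<close>

lemma sat_morphism: "u \<in> states N \<Longrightarrow> sat N' \<phi> (f u) \<longleftrightarrow> sat N \<phi> u"
  and path_prob_morphism: "u \<in> states N \<Longrightarrow> path_prob N' (f u) \<Phi> = path_prob N u \<Phi>"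
proof (induction \<phi> and \<Phi> arbitrary: u and u)
  case (Prob \<Phi> c r)
  then show ?case by (simp only: sat_Prob_iff)
next
  case (Finally \<phi>)
  then show ?case
    unfolding path_prob_Finally by (subst stay_morphism[where A = "{v. \<not> sat N \<phi> v}"]) auto
next
  case (Globally \<phi>)
  then show ?case
    unfolding path_prob_Globally by (subst stay_morphism[where A = "{v. sat N \<phi> v}"]) auto
qed (auto simp: f_val)

end

subsection \<open>Exit distributions\<close>

lemma reachable_refl [simp]: "reachable M s s"
  by (simp add: reachable_def)

lemma reachable_trans: "reachable M s t \<Longrightarrow> reachable M t u \<Longrightarrow> reachable M s u"
  by (simp add: reachable_def)

lemma reachable_succ: "reachable M s t \<Longrightarrow> u \<in> set_pmf (trans M t) \<Longrightarrow> reachable M s u"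
  unfolding reachable_def by (erule rtrancl_into_rtrancl) (simp add: pmf_positive_iff)

lemma reachable_induct [consumes 1, case_names refl step]:
  assumes "reachable M s u" and "P s"
    and "\<And>t u. reachable M s t \<Longrightarrow> P t \<Longrightarrow> u \<in> set_pmf (trans M t) \<Longrightarrow> P u"
  shows "P u"
  using assms(1) unfolding reachable_def
proof (induction rule: rtrancl_induct)
  case base
  show ?case by fact
next
  case (step t u)
  then show ?case using assms(3)[of t u] by (auto simp: reachable_def pmf_positive_iff)
qed

section \<open>Maximum principle and closed sets of states\<close>

context finite_chain
begin

lemma reachable_states: "reachable M s u \<Longrightarrow> s \<in> S \<Longrightarrow> u \<in> S"
  by (induction rule: reachable_induct) (use succ_closed in auto)

text \<open>The weighted differences \<open>m - d v\<close> are nonnegative and their sum is at most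
  0, so each of them vanishes where the weight is positive.\<close>

lemma average_eq_bound:
  assumes u: "u \<in> S" and le: "\<And>v. v \<in> set_pmf (trans M u) \<Longrightarrow> d v \<le> m"
    and ge: "m \<le> E u d" and v: "v \<in> set_pmf (trans M u)"
  shows "d v = m"
proof -
  have eq: "(\<Sum>v\<in>S. pmf (trans M u) v * (m - d v)) = m - E u d"
    using u by (simp add: E_sum right_diff_distrib sum_subtractf sum_pmf flip: sum_distrib_right)
  have nonneg: "0 \<le> pmf (trans M u) v * (m - d v)" for v
    using le[of v] by (cases "v \<in> set_pmf (trans M u)") (auto simp: set_pmf_iff)
  have "0 \<le> (\<Sum>v\<in>S. pmf (trans M u) v * (m - d v))"
    using nonneg by (intro sum_nonneg)
  with eq ge have "(\<Sum>v\<in>S. pmf (trans M u) v * (m - d v)) = 0"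
    by linarith
  then have "pmf (trans M u) v * (m - d v) = 0"
    using sum_nonneg_eq_0_iff[OF fin nonneg] succ_closed[OF u] v by auto
  then show ?thesis using v by (auto simp: set_pmf_iff)
qed

text \<open>Let \<open>U\<close> be the set of maximisers of \<open>d\<close> on \<open>R\<close>.
  Outside \<open>B\<close> the value of \<open>d\<close> is at most the average over the successors,
  so all successors of a maximiser are maximisers. Hence \<open>U\<close> either meets
  \<open>B\<close> or is closed under transitions.\<close>

lemma maximum_principle:
  assumes R: "R \<subseteq> S" "R \<noteq> {}" "\<And>u. u \<in> R \<Longrightarrow> set_pmf (trans M u) \<subseteq> R"
    and sub: "\<And>u. u \<in> R - B \<Longrightarrow> d u \<le> E u d"
  obtains m where "\<And>v. v \<in> R \<Longrightarrow> d v \<le> m"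
    and "(\<exists>b\<in>R \<inter> B. d b = m) \<or>
      (\<exists>U\<subseteq>R - B. U \<noteq> {} \<and> (\<forall>u\<in>U. set_pmf (trans M u) \<subseteq> U \<and> d u = m))"
proof -
  have finR: "finite R" using R fin finite_subset by blast
  define m where "m = Max (d ` R)"
  define U where "U = {u \<in> R. d u = m}"
  have le: "d v \<le> m" if "v \<in> R" for v
    using that finR by (simp add: m_def)
  have "m \<in> d ` R" unfolding m_def using finR R by (intro Max_in) auto
  then have "U \<noteq> {}" by (auto simp: U_def)
  moreover have "set_pmf (trans M u) \<subseteq> U" if "u \<in> U - B" for u
  proof
    fix v assume v: "v \<in> set_pmf (trans M u)"
    have "d v = m"
    proof (rule average_eq_bound[OF _ _ _ v])
      show "u \<in> S" using that R by (auto simp: U_def)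
      show "m \<le> E u d" using that sub[of u] by (auto simp: U_def)
      show "d v \<le> m" if "v \<in> set_pmf (trans M u)" for v
        using that \<open>u \<in> U - B\<close> R le by (auto simp: U_def)
    qed
    then show "v \<in> U" using that v R by (auto simp: U_def)
  qed
  ultimately have "(\<exists>b\<in>R \<inter> B. d b = m) \<or>
      (\<exists>U\<subseteq>R - B. U \<noteq> {} \<and> (\<forall>u\<in>U. set_pmf (trans M u) \<subseteq> U \<and> d u = m))"
  proof (cases "U \<inter> B = {}")
    case True
    then have "U \<subseteq> R - B" "\<forall>u\<in>U. set_pmf (trans M u) \<subseteq> U \<and> d u = m"
      using \<open>\<And>u. u \<in> U - B \<Longrightarrow> set_pmf (trans M u) \<subseteq> U\<close> by (auto simp: U_def)
    with \<open>U \<noteq> {}\<close> show ?thesis by blast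
  qed (auto simp: U_def)
  with le that show thesis by blast
qed

text \<open>The indicator of \<open>U\<close> is a post-fixed point, so \<open>stay_greatest\<close>
  applies.\<close>

lemma stay_closed:
  assumes U: "U \<subseteq> S" "\<And>u. u \<in> U \<Longrightarrow> set_pmf (trans M u) \<subseteq> U" "U \<subseteq> A" and u: "u \<in> U"
  shows "stay M A u = 1"
proof -
  have "indicator U u \<le> stay M A u"
  proof (rule stay_greatest)
    fix v assume v: "v \<in> S"
    show "indicator U v \<le> indicator A v * E v (indicator U)"
    proof (cases "v \<in> U")
      case True
      have "E v (indicator U) = E v (\<lambda>_. 1)"
        using U(2)[OF True] by (intro integral_cong_AE) (auto simp: AE_measure_pmf_iff)
      then show ?thesis using True U by auto
    qed simp
  qed (use u U in \<open>auto simp: indicator_def\<close>)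
  with u stay_le_1[of M A u] show ?thesis by (simp add: antisym)
qed

text \<open>The value 1 at \<open>u\<close> is the average over the successors and also the largest
  possible value, so every successor attains it.\<close>

lemma Globally_1_succ:
  assumes "u \<in> S" "path_prob M u (Globally \<xi>) = 1" "v \<in> set_pmf (trans M u)"
  shows "path_prob M v (Globally \<xi>) = 1"
  by (rule average_eq_bound[OF assms(1) _ _ assms(3)])
    (use assms path_prob_Globally_step[OF assms(1), of \<xi>] in \<open>auto split: if_splits\<close>)

lemma Globally_1_reachable:
  assumes "reachable M s u" "s \<in> S" "path_prob M s (Globally \<xi>) = 1"
  shows "path_prob M u (Globally \<xi>) = 1"
  using assms(1)
  by (induction rule: reachable_induct)
    (use assms Globally_1_succ reachable_states in blast)+

lemma sat_Globally_1: "sat M (Prob (Globally \<xi>) GE 1) u \<longleftrightarrow> path_prob M u (Globally \<xi>) = 1"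
  using path_prob_le_1[of M u "Globally \<xi>"] unfolding sat_Prob_iff by (simp add: order.antisym)

section \<open>First-entry probabilities and exit weights\<close>

primrec hit :: "'s set \<Rightarrow> 's \<Rightarrow> nat \<Rightarrow> 's \<Rightarrow> real" where
  "hit T t 0 u = of_bool (u = t)"
| "hit T t (Suc n) u = (if u \<in> T then of_bool (u = t) else E u (hit T t n))"

text \<open>For \<open>t\<close> in \<open>T\<close>, \<open>hit T t n u\<close> is the probability
  of entering \<open>T\<close> first at \<open>t\<close> within \<open>n\<close> steps;
  \<open>q\<close> is its increasing limit. Runs may miss \<open>T\<close> altogether, so the total
  weight may stay below 1.\<close>

lemma hitting_weights:
  assumes T: "T \<subseteq> S"
  obtains q where "\<And>u t. u \<in> S \<Longrightarrow> t \<in> T \<Longrightarrow> 0 \<le> q u t"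
    and "\<And>u. u \<in> S \<Longrightarrow> (\<Sum>t\<in>T. q u t) \<le> 1"
    and "\<And>u t. u \<in> T \<Longrightarrow> t \<in> T \<Longrightarrow> q u t = of_bool (u = t)"
    and "\<And>u t. u \<in> S - T \<Longrightarrow> t \<in> T \<Longrightarrow> q u t = E u (\<lambda>v. q v t)"
proof -
  have finT: "finite T" using T fin finite_subset by blast
  have nonneg: "0 \<le> hit T t n u" for t n u
    by (induction n arbitrary: u) auto
  have sum_le: "(\<Sum>t\<in>T. hit T t n u) \<le> 1" if "u \<in> S" for n u
    using that
  proof (induction n arbitrary: u)
    case 0
    then show ?case using finT by (simp add: of_bool_def)
  next
    case (Suc n)
    show ?case
    proof (cases "u \<in> T")
      case True
      then show ?thesis using finT by (simp add: of_bool_def)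
    next
      case False
      then have "(\<Sum>t\<in>T. hit T t (Suc n) u) = E u (\<lambda>v. \<Sum>t\<in>T. hit T t n v)"
        using Suc.prems by (simp add: E_sum sum_distrib_left) (rule sum.swap)
      also have "\<dots> \<le> E u (\<lambda>_. 1)"
        using Suc by (intro E_mono) auto
      finally show ?thesis by simp
    qed
  qed
  have mono: "hit T t n u \<le> hit T t (Suc n) u" if "u \<in> S" "t \<in> T" for t n u
    using that(1)
  proof (induction n arbitrary: u)
    case 0
    then show ?case using that(2) nonneg[of t 0] by auto
  next
    case (Suc n)
    have "E u (hit T t n) \<le> E u (hit T t (Suc n))"
      using Suc by (intro E_mono) blast+
    then show ?case by (simp only: hit.simps) auto
  qed
  have le_1: "hit T t n u \<le> 1" if "u \<in> S" "t \<in> T" for t n u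
    using member_le_sum[of t T "\<lambda>t. hit T t n u"] sum_le[OF that(1), of n] that nonneg finT
    by fastforce
  define q where "q u t = lim (\<lambda>n. hit T t n u)" for u t
  have lim: "(\<lambda>n. hit T t n u) \<longlonglongrightarrow> q u t" if "u \<in> S" "t \<in> T" for u t
  proof -
    have "incseq (\<lambda>n. hit T t n u)" using mono[OF that] by (rule incseq_SucI)
    moreover have "\<forall>n. hit T t n u \<le> 1" using le_1[OF that] by blast
    ultimately obtain L where "(\<lambda>n. hit T t n u) \<longlonglongrightarrow> L"
      by (rule incseq_convergent)
    then show ?thesis unfolding q_def by (simp add: limI)
  qed
  show thesis
  proof
    show "0 \<le> q u t" if "u \<in> S" "t \<in> T" for u t
      using lim[OF that] nonneg by (intro LIMSEQ_le_const) auto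
    show "(\<Sum>t\<in>T. q u t) \<le> 1" if "u \<in> S" for u
    proof (rule LIMSEQ_le_const2)
      show "(\<lambda>n. \<Sum>t\<in>T. hit T t n u) \<longlonglongrightarrow> (\<Sum>t\<in>T. q u t)"
        using that lim by (intro tendsto_sum) auto
    qed (use sum_le that in auto)
    show "q u t = of_bool (u = t)" if "u \<in> T" "t \<in> T" for u t
    proof (rule LIMSEQ_unique)
      show "(\<lambda>n. hit T t (Suc n) u) \<longlonglongrightarrow> q u t"
        using lim[of u t] that T by (intro LIMSEQ_Suc) auto
    qed (use that in simp)
    show "q u t = E u (\<lambda>v. q v t)" if "u \<in> S - T" "t \<in> T" for u t
    proof (rule LIMSEQ_unique)
      show "(\<lambda>n. hit T t (Suc n) u) \<longlonglongrightarrow> q u t"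
        using lim[of u t] that by (intro LIMSEQ_Suc) auto
      show "(\<lambda>n. hit T t (Suc n) u) \<longlonglongrightarrow> E u (\<lambda>v. q v t)"
        using that by (auto simp: E_sum intro!: tendsto_intros lim)
    qed
  qed
qed

text \<open>Both inequalities compare a probability with its expected value on first entry into
  \<open>T\<close>. By the maximum principle only closed sets avoiding \<open>T\<close> could spoil
  the comparison; the two side conditions ensure that the probability vanishes somewhere in each of
  them.\<close>

lemma exit_weights:
  assumes s: "s \<in> S" and T: "T \<subseteq> {u. reachable M s u}"
  obtains q where "\<And>t. t \<in> T \<Longrightarrow> 0 \<le> q t" and "(\<Sum>t\<in>T. q t) \<le> 1"
    and "\<And>\<phi>. (\<And>u. reachable M s u \<Longrightarrow> u \<notin> T \<Longrightarrow> \<not> sat M \<phi> u) \<Longrightarrow>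
       path_prob M s (Finally \<phi>) \<le> (\<Sum>t\<in>T. q t * path_prob M t (Finally \<phi>))"
    and "\<And>\<xi>. (\<And>u. reachable M s u \<Longrightarrow> u \<notin> T \<Longrightarrow> path_prob M u (Globally \<xi>) \<noteq> 1) \<Longrightarrow>
       path_prob M s (Globally \<xi>) \<le> (\<Sum>t\<in>T. q t * path_prob M t (Globally \<xi>))"
proof -
  define R where "R = {u. reachable M s u}"
  have RS: "R \<subseteq> S" using reachable_states s by (auto simp: R_def)
  have Rcl: "set_pmf (trans M u) \<subseteq> R" if "u \<in> R" for u
    using that by (auto simp: R_def intro: reachable_succ)
  have sR: "s \<in> R" by (simp add: R_def)
  have TS: "T \<subseteq> S" using T RS by (auto simp: R_def)
  have finT: "finite T" using TS fin finite_subset by blast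
  obtain q where q: "\<And>u t. u \<in> S \<Longrightarrow> t \<in> T \<Longrightarrow> 0 \<le> q u t"
    "\<And>u. u \<in> S \<Longrightarrow> (\<Sum>t\<in>T. q u t) \<le> 1"
    "\<And>u t. u \<in> T \<Longrightarrow> t \<in> T \<Longrightarrow> q u t = of_bool (u = t)"
    "\<And>u t. u \<in> S - T \<Longrightarrow> t \<in> T \<Longrightarrow> q u t = E u (\<lambda>v. q v t)"
    by (rule hitting_weights[OF TS]) blast
  have key: "g s \<le> (\<Sum>t\<in>T. q s t * g t)"
    if nonneg: "\<And>u. 0 \<le> g u" and sub: "\<And>u. u \<in> R - T \<Longrightarrow> g u \<le> E u g"
      and null: "\<And>U u. U \<subseteq> R - T \<Longrightarrow> U \<noteq> {} \<Longrightarrow> (\<And>v. v \<in> U \<Longrightarrow> set_pmf (trans M v) \<subseteq> U) \<Longrightarrow>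
         \<exists>u\<in>U. g u = 0" for g
  proof -
    \<comment> \<open>\<open>W\<close> extends the values of \<open>g\<close> on \<open>T\<close>
      harmonically to the rest. Then \<open>d\<close> is subharmonic off \<open>T\<close> and zero
      on \<open>T\<close>, and the goal is that its maximum is not positive.\<close>
    define W where "W u = (\<Sum>t\<in>T. q u t * g t)" for u
    define d where "d u = g u - W u" for u
    have W_nonneg: "0 \<le> W u" if "u \<in> S" for u
      unfolding W_def using that q(1) nonneg by (intro sum_nonneg mult_nonneg_nonneg) auto
    have W_E: "W u = E u W" if "u \<in> S - T" for u
    proof -
      have "W u = (\<Sum>t\<in>T. \<Sum>v\<in>S. pmf (trans M u) v * (q v t * g t))"
        unfolding W_def using that
        by (intro sum.cong refl, subst q(4)) (auto simp: E_sum sum_distrib_right mult.assoc)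
      also have "\<dots> = (\<Sum>v\<in>S. \<Sum>t\<in>T. pmf (trans M u) v * (q v t * g t))"
        by (rule sum.swap)
      also have "\<dots> = E u W"
        using that by (simp add: E_sum W_def sum_distrib_left)
      finally show ?thesis .
    qed
    have W_T: "W u = g u" if "u \<in> T" for u
    proof -
      have "W u = (\<Sum>t\<in>T. if u = t then g t else 0)"
        unfolding W_def using that by (intro sum.cong) (auto simp: q(3))
      then show ?thesis using finT that by simp
    qed
    have d_sub: "d u \<le> E u d" if "u \<in> R - T" for u
    proof -
      have "E u d = E u g - E u W"
        using that RS by (auto simp: d_def E_sum right_diff_distrib sum_subtractf)
      with sub[OF that] W_E[of u] that RS show ?thesis by (auto simp: d_def)
    qed
    obtain m where m: "\<And>v. v \<in> R \<Longrightarrow> d v \<le> m"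
      and alt: "(\<exists>b\<in>R \<inter> T. d b = m) \<or>
      (\<exists>U\<subseteq>R - T. U \<noteq> {} \<and> (\<forall>u\<in>U. set_pmf (trans M u) \<subseteq> U \<and> d u = m))"
      using maximum_principle[OF RS _ Rcl d_sub] sR by (metis empty_iff)
    have "m \<le> 0"
      using alt
    proof
      assume "\<exists>b\<in>R \<inter> T. d b = m"
      then show ?thesis using W_T by (auto simp: d_def)
    next
      assume "\<exists>U\<subseteq>R - T. U \<noteq> {} \<and> (\<forall>u\<in>U. set_pmf (trans M u) \<subseteq> U \<and> d u = m)"
      then obtain U where U: "U \<subseteq> R - T" "U \<noteq> {}" "\<And>u. u \<in> U \<Longrightarrow> set_pmf (trans M u) \<subseteq> U"
        "\<And>u. u \<in> U \<Longrightarrow> d u = m" by blast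
      from null[OF U(1-3)] obtain u where u: "u \<in> U" "g u = 0" by blast
      with U(4)[OF u(1)] W_nonneg[of u] U(1) RS show ?thesis by (auto simp: d_def)
    qed
    with m[OF sR] show ?thesis by (simp add: d_def W_def)
  qed
  show thesis
  proof (rule that)
    show "0 \<le> q s t" if "t \<in> T" for t using q(1) s that by blast
    show "(\<Sum>t\<in>T. q s t) \<le> 1" using q(2) s by blast
    show "path_prob M s (Finally \<phi>) \<le> (\<Sum>t\<in>T. q s t * path_prob M t (Finally \<phi>))"
      if no: "\<And>u. reachable M s u \<Longrightarrow> u \<notin> T \<Longrightarrow> \<not> sat M \<phi> u" for \<phi>
    proof (rule key)
      show "path_prob M u (Finally \<phi>) \<le> E u (\<lambda>v. path_prob M v (Finally \<phi>))" if "u \<in> R - T" for u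
        using that no[of u] RS path_prob_Finally_step[of u \<phi>] by (auto simp: R_def)
      show "\<exists>u\<in>U. path_prob M u (Finally \<phi>) = 0"
        if U: "U \<subseteq> R - T" "U \<noteq> {}" "\<And>v. v \<in> U \<Longrightarrow> set_pmf (trans M v) \<subseteq> U" for U
      proof -
        have "stay M {v. \<not> sat M \<phi> v} u = 1" if "u \<in> U" for u
          by (rule stay_closed[of U]) (use U RS no that in \<open>auto simp: R_def\<close>)
        with U show ?thesis unfolding path_prob_Finally by auto
      qed
    qed simp
    show "path_prob M s (Globally \<xi>) \<le> (\<Sum>t\<in>T. q s t * path_prob M t (Globally \<xi>))"
      if no: "\<And>u. reachable M s u \<Longrightarrow> u \<notin> T \<Longrightarrow> path_prob M u (Globally \<xi>) \<noteq> 1" for \<xi>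
    proof (rule key)
      show "path_prob M u (Globally \<xi>) \<le> E u (\<lambda>v. path_prob M v (Globally \<xi>))" if "u \<in> R - T" for u
        using that RS path_prob_Globally_step[of u \<xi>] by auto
      show "\<exists>u\<in>U. path_prob M u (Globally \<xi>) = 0"
        if U: "U \<subseteq> R - T" "U \<noteq> {}" "\<And>v. v \<in> U \<Longrightarrow> set_pmf (trans M v) \<subseteq> U" for U
      \<comment> \<open>If the probability vanished nowhere in the closed set, \<open>\<xi>\<close>
        would hold throughout it, which makes the probability 1 there and contradicts
        \<open>no\<close>.\<close>
      proof (rule ccontr)
        assume *: "\<not> (\<exists>u\<in>U. path_prob M u (Globally \<xi>) = 0)"
        obtain u where u: "u \<in> U" using U by auto
        have "sat M \<xi> v" if "v \<in> U" for v
          using that * U RS path_prob_Globally_step[of v \<xi>] by (auto split: if_splits)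
        then have "stay M {v. sat M \<xi> v} u = 1"
          using U RS u by (intro stay_closed[of U]) auto
        with no[of u] u U show False by (auto simp: path_prob_Globally R_def)
      qed
    qed simp
  qed
qed

end

section \<open>Reducing the support of the exit distribution\<close>

text \<open>Gaussian elimination, one equation per induction step: each step uses up one equation
  and at most one unknown, so an unknown is left when the equations run out.\<close>

lemma homogeneous_system_nontrivial:
  fixes x :: "'f \<Rightarrow> 't \<Rightarrow> real"
  assumes "finite D" and "finite T" and "card D < card T"
  obtains z where "\<exists>t\<in>T. z t \<noteq> 0" and "\<And>f. f \<in> D \<Longrightarrow> (\<Sum>t\<in>T. z t * x f t) = 0"
proof -
  have "\<exists>z. (\<exists>t\<in>T. z t \<noteq> 0) \<and> (\<forall>f\<in>D. (\<Sum>t\<in>T. z t * x f t) = 0)"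
    using assms
  proof (induction D arbitrary: T x rule: finite_induct)
    case empty
    then have "T \<noteq> {}" by auto
    then show ?case by (auto intro!: exI[of _ "\<lambda>_. 1"])
  next
    case (insert f D)
    show ?case
    proof (cases "\<forall>t\<in>T. x f t = 0")
      case True
      from insert.IH[of T x] insert.prems insert.hyps obtain z
        where "\<exists>t\<in>T. z t \<noteq> 0" "\<forall>f\<in>D. (\<Sum>t\<in>T. z t * x f t) = 0" by auto
      with True show ?thesis by (intro exI[of _ z]) auto
    next
      case False
      then obtain t0 where t0: "t0 \<in> T" "x f t0 \<noteq> 0" by auto
      \<comment> \<open>Equation \<open>f\<close> is solved for the unknown at \<open>t0\<close>,
        and \<open>x'\<close> is the system left after substitution. The value \<open>a\<close>
        below is what equation \<open>f\<close> forces at \<open>t0\<close>.\<close>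
      define T' where "T' = T - {t0}"
      define x' where "x' g t = x g t - x g t0 * x f t / x f t0" for g t
      have "card D < card T'" "finite T'"
        using insert.prems insert.hyps t0 by (auto simp: T'_def)
      then obtain z where z: "\<exists>t\<in>T'. z t \<noteq> 0" "\<And>g. g \<in> D \<Longrightarrow> (\<Sum>t\<in>T'. z t * x' g t) = 0"
        using insert.IH[of T' x'] by blast
      define a where "a = - (\<Sum>t\<in>T'. z t * x f t) / x f t0"
      define z' where "z' = z(t0 := a)"
      have sum_T: "(\<Sum>t\<in>T. z' t * x g t) = a * x g t0 + (\<Sum>t\<in>T'. z t * x g t)" for g
      proof -
        have "(\<Sum>t\<in>T. z' t * x g t) = z' t0 * x g t0 + (\<Sum>t\<in>T'. z' t * x g t)"
          unfolding T'_def using t0 insert.prems by (intro sum.remove) auto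
        also have "(\<Sum>t\<in>T'. z' t * x g t) = (\<Sum>t\<in>T'. z t * x g t)"
          by (intro sum.cong) (auto simp: z'_def T'_def)
        finally show ?thesis by (simp add: z'_def)
      qed
      have "(\<Sum>t\<in>T. z' t * x g t) = 0" if "g \<in> D" for g
      proof -
        have "0 = (\<Sum>t\<in>T'. z t * x g t) - (\<Sum>t\<in>T'. z t * x f t) * (x g t0 / x f t0)"
          using z(2)[OF that]
          by (simp add: x'_def right_diff_distrib sum_subtractf sum_distrib_left sum_divide_distrib
              mult_ac)
        then show ?thesis by (simp add: sum_T a_def)
      qed
      moreover have "(\<Sum>t\<in>T. z' t * x f t) = 0"
        using t0 by (simp add: sum_T a_def)
      moreover have "\<exists>t\<in>T. z' t \<noteq> 0"
        using z(1) by (auto simp: z'_def T'_def)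
      ultimately show ?thesis by blast
    qed
  qed
  then show thesis using that by blast
qed

text \<open>In the library's version of Caratheodory's theorem the dimension is given by a type; here it is the
  number of path formulae in \<open>\<Delta>\<close>.\<close>

lemma caratheodory_weights:
  fixes x :: "'f \<Rightarrow> 't \<Rightarrow> real"
  assumes "finite D" and "finite T" and "\<And>t. t \<in> T \<Longrightarrow> 0 \<le> w t"
  obtains w' where "\<And>t. t \<in> T \<Longrightarrow> 0 \<le> w' t" and "sum w' T = sum w T"
    and "\<And>f. f \<in> D \<Longrightarrow> (\<Sum>t\<in>T. w' t * x f t) = (\<Sum>t\<in>T. w t * x f t)"
    and "card {t\<in>T. w' t \<noteq> 0} \<le> card D + 1"
proof -
  have "\<exists>w'. (\<forall>t\<in>T. 0 \<le> w' t) \<and> sum w' T = sum w T \<and>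
    (\<forall>f\<in>D. (\<Sum>t\<in>T. w' t * x f t) = (\<Sum>t\<in>T. w t * x f t)) \<and> card {t\<in>T. w' t \<noteq> 0} \<le> card D + 1"
    using assms(3)
  proof (induction "card {t\<in>T. w t \<noteq> 0}" arbitrary: w rule: less_induct)
    case less
    define V where "V = {t\<in>T. w t \<noteq> 0}"
    have finV: "finite V" using assms by (simp add: V_def)
    show ?case
    proof (cases "card V \<le> card D + 1")
      case True
      then show ?thesis using less.prems by (auto simp: V_def)
    next
      case False
      \<comment> \<open>The additional row \<open>None\<close> is constantly 1, so moving the
        weights along \<open>z\<close> preserves their sum.\<close>
      define y where "y f t = (case f of None \<Rightarrow> 1 | Some f \<Rightarrow> x f t)" for f t
      have "card (insert None (Some ` D)) < card V"
        using False assms by (simp add: card_image)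
      then obtain z where z: "\<exists>t\<in>V. z t \<noteq> 0"
        "\<And>f. f \<in> insert None (Some ` D) \<Longrightarrow> (\<Sum>t\<in>V. z t * y f t) = 0"
        using homogeneous_system_nontrivial[of "insert None (Some ` D)" V y] assms finV by blast
      have z_sum: "sum z V = 0" using z(2)[of None] by (simp add: y_def)
      have z_x: "(\<Sum>t\<in>V. z t * x f t) = 0" if "f \<in> D" for f
        using z(2)[of "Some f"] that by (simp add: y_def)
      have "\<exists>t\<in>V. 0 < z t"
      proof (rule ccontr)
        assume "\<not> ?thesis"
        then have "\<forall>t\<in>V. 0 \<le> - z t" by auto
        moreover have "(\<Sum>t\<in>V. - z t) = 0" using z_sum by (simp add: sum_negf)
        ultimately have "\<forall>t\<in>V. - z t = 0" 
          using sum_nonneg_eq_0_iff[OF finV, of "\<lambda>t. - z t"] by simp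
        with z(1) show False by auto
      qed
      define Q where "Q = {t\<in>V. 0 < z t}"
      have Q: "finite Q" "Q \<noteq> {}" using finV \<open>\<exists>t\<in>V. 0 < z t\<close> by (auto simp: Q_def)
      \<comment> \<open>The largest multiple of \<open>z\<close> that can be subtracted while all
        weights stay nonnegative; at a minimiser \<open>t0\<close> the weight drops to 0, which
        shrinks the support.\<close>
      define \<theta> where "\<theta> = Min ((\<lambda>t. w t / z t) ` Q)"
      have "\<theta> \<in> (\<lambda>t. w t / z t) ` Q" unfolding \<theta>_def using Q by (intro Min_in) auto
      then obtain t0 where t0: "t0 \<in> Q" "\<theta> = w t0 / z t0" by auto
      have \<theta>_le: "\<theta> \<le> w t / z t" if "t \<in> Q" for t
        unfolding \<theta>_def using that Q by simp
      have w_pos: "0 < w t" if "t \<in> V" for t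
        using that less.prems[of t] by (auto simp: V_def)
      have \<theta>_pos: "0 < \<theta>" using t0 w_pos by (auto simp: Q_def)
      define w' where "w' t = (if t \<in> V then w t - \<theta> * z t else 0)" for t
      have "0 \<le> w' t" for t
      proof (cases "t \<in> Q")
        case True
        with \<theta>_le[OF True] show ?thesis by (auto simp: w'_def Q_def field_simps)
      next
        case False
        then have "t \<in> V \<Longrightarrow> \<theta> * z t \<le> 0"
          using \<theta>_pos by (auto simp: Q_def mult_le_0_iff)
        then show ?thesis using w_pos[of t] by (auto simp: w'_def)
      qed
      moreover have sums: "(\<Sum>t\<in>T. w' t * g t) = (\<Sum>t\<in>T. w t * g t)"
        if "(\<Sum>t\<in>V. z t * g t) = 0" for g
      proof -
        have "(\<Sum>t\<in>T. w' t * g t) = (\<Sum>t\<in>V. w' t * g t)"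
          using assms by (intro sum.mono_neutral_right) (auto simp: V_def w'_def)
        also have "\<dots> = (\<Sum>t\<in>V. w t * g t) - \<theta> * (\<Sum>t\<in>V. z t * g t)"
          by (simp add: w'_def left_diff_distrib sum_subtractf sum_distrib_left mult.assoc)
        also have "(\<Sum>t\<in>V. w t * g t) = (\<Sum>t\<in>T. w t * g t)"
          using assms by (intro sum.mono_neutral_left) (auto simp: V_def)
        finally show ?thesis using that by simp
      qed
      moreover have "{t\<in>T. w' t \<noteq> 0} \<subset> V"
      proof -
        have "w' t0 = 0" "t0 \<in> V" using t0 by (auto simp: w'_def Q_def)
        then show ?thesis by (auto simp: w'_def split: if_splits)
      qed
      then have "card {t\<in>T. w' t \<noteq> 0} < card V" using finV by (rule psubset_card_mono[rotated])
      ultimately obtain w'' where "\<forall>t\<in>T. 0 \<le> w'' t" "sum w'' T = sum w' T"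
        "\<forall>f\<in>D. (\<Sum>t\<in>T. w'' t * x f t) = (\<Sum>t\<in>T. w' t * x f t)" "card {t\<in>T. w'' t \<noteq> 0} \<le> card D + 1"
        using less.hyps[of w'] unfolding V_def by blast
      moreover have "sum w' T = sum w T" using sums[of "\<lambda>_. 1"] z_sum by simp
      ultimately show ?thesis using sums[OF z_x] by (intro exI[of _ w'']) auto
    qed
  qed
  then show thesis using that by blast
qed

lemma pmf_of_weights:
  fixes w :: "'t \<Rightarrow> real"
  assumes "finite T" and "\<And>t. t \<in> T \<Longrightarrow> 0 \<le> w t" and "sum w T = 1"
  obtains \<mu> where "set_pmf \<mu> = {t\<in>T. w t \<noteq> 0}"
    and "\<And>h. measure_pmf.expectation \<mu> h = (\<Sum>t\<in>T. w t * (h t :: real))"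
proof -
  define f where "f t = (if t \<in> T then w t else 0)" for t
  have f_nonneg: "0 \<le> f t" for t using assms by (simp add: f_def)
  have "(\<integral>\<^sup>+ t. ennreal (f t) \<partial>count_space UNIV) = (\<Sum>t\<in>T. ennreal (f t))"
    using assms by (intro nn_integral_count_space'[of T]) (auto simp: f_def)
  also have "\<dots> = 1"
    using assms f_nonneg by (simp add: sum_ennreal) (simp add: f_def)
  finally have pmf: "pmf (embed_pmf f) t = f t" for t
    using f_nonneg by (intro pmf_embed_pmf) auto
  show thesis
  proof
    show supp: "set_pmf (embed_pmf f) = {t\<in>T. w t \<noteq> 0}"
      by (auto simp: set_pmf_iff pmf f_def split: if_splits)
    show "measure_pmf.expectation (embed_pmf f) h = (\<Sum>t\<in>T. w t * h t)" for h
      by (subst integral_measure_pmf[OF assms(1)]) (auto simp: supp pmf f_def)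
  qed
qed

text \<open>The exit weights are normalised by their total \<open>p\<close> and then thinned out by
  \<open>caratheodory_weights\<close>. Division by \<open>p \<le> 1\<close> can only raise the
  averages. If \<open>p = 0\<close> there is nothing to normalise, which is the first
  alternative.\<close>

lemma (in finite_chain) exit_distribution:
  assumes s: "s \<in> S" and T: "T \<subseteq> {u. reachable M s u}" and D: "finite D"
    and F: "\<And>\<phi> u. Finally \<phi> \<in> D \<Longrightarrow> reachable M s u \<Longrightarrow> u \<notin> T \<Longrightarrow> \<not> sat M \<phi> u"
    and G: "\<And>\<xi> u. Globally \<xi> \<in> D \<Longrightarrow> path_prob M s (Globally \<xi>) \<noteq> 1 \<Longrightarrow>
       reachable M s u \<Longrightarrow> u \<notin> T \<Longrightarrow> path_prob M u (Globally \<xi>) \<noteq> 1"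
    and pos: "\<And>\<Phi>. \<Phi> \<in> D \<Longrightarrow> 0 < path_prob M s \<Phi>"
  shows "(\<forall>\<Phi>\<in>D. \<exists>\<xi>. \<Phi> = Globally \<xi>) \<or>
    (\<exists>\<mu>. set_pmf \<mu> \<subseteq> T \<and> card (set_pmf \<mu>) \<le> card D + 1 \<and>
       (\<forall>\<Phi>\<in>D. path_prob M s \<Phi> \<le> measure_pmf.expectation \<mu> (\<lambda>t. path_prob M t \<Phi>)))"
proof -
  have TS: "T \<subseteq> S" using T reachable_states s by auto
  have finT: "finite T" using TS fin finite_subset by blast
  obtain q where q: "\<And>t. t \<in> T \<Longrightarrow> 0 \<le> q t" "(\<Sum>t\<in>T. q t) \<le> 1"
    "\<And>\<phi>. (\<And>u. reachable M s u \<Longrightarrow> u \<notin> T \<Longrightarrow> \<not> sat M \<phi> u) \<Longrightarrow>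
       path_prob M s (Finally \<phi>) \<le> (\<Sum>t\<in>T. q t * path_prob M t (Finally \<phi>))"
    "\<And>\<xi>. (\<And>u. reachable M s u \<Longrightarrow> u \<notin> T \<Longrightarrow> path_prob M u (Globally \<xi>) \<noteq> 1) \<Longrightarrow>
       path_prob M s (Globally \<xi>) \<le> (\<Sum>t\<in>T. q t * path_prob M t (Globally \<xi>))"
    by (rule exit_weights[OF s T]) blast
  have le: "path_prob M s \<Phi> \<le> (\<Sum>t\<in>T. q t * path_prob M t \<Phi>)"
    if "\<Phi> \<in> D" "\<nexists>\<xi>. \<Phi> = Globally \<xi> \<and> path_prob M s (Globally \<xi>) = 1" for \<Phi>
  proof (cases \<Phi>)
    case (Finally \<phi>)
    with q(3)[of \<phi>] F that show ?thesis by auto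
  next
    case (Globally \<xi>)
    with q(4)[of \<xi>] G that show ?thesis by auto
  qed
  define p where "p = sum q T"
  have "0 \<le> p" unfolding p_def using q by (intro sum_nonneg)
  show ?thesis
  proof (cases "p = 0")
    case True
    \<comment> \<open>Without exit weight, \<open>le\<close> bounds by 0 the probability of every
      path formula except the \<open>Globally\<close> formulae of probability one, against
      \<open>pos\<close>.\<close>
    then have "\<forall>t\<in>T. q t = 0"
      unfolding p_def using q(1) sum_nonneg_eq_0_iff[OF finT] by blast
    then have "(\<Sum>t\<in>T. q t * path_prob M t \<Phi>) = 0" for \<Phi> by simp
    then have "\<exists>\<xi>. \<Phi> = Globally \<xi>" if "\<Phi> \<in> D" for \<Phi>
      using le[OF that] pos[OF that] by force
    then show ?thesis by blast
  next
    case False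
    with \<open>0 \<le> p\<close> have p: "0 < p" "p \<le> 1" using q(2) by (auto simp: p_def)
    have sum1: "(\<Sum>t\<in>T. q t / p) = 1"
      using p by (simp add: p_def flip: sum_divide_distrib)
    obtain w where w: "\<And>t. t \<in> T \<Longrightarrow> 0 \<le> w t" "sum w T = (\<Sum>t\<in>T. q t / p)"
      "\<And>\<Phi>. \<Phi> \<in> D \<Longrightarrow> (\<Sum>t\<in>T. w t * path_prob M t \<Phi>) = (\<Sum>t\<in>T. q t / p * path_prob M t \<Phi>)"
      "card {t\<in>T. w t \<noteq> 0} \<le> card D + 1"
      by (rule caratheodory_weights[OF D finT, where w = "\<lambda>t. q t / p" and x = "\<lambda>\<Phi> t. path_prob M t \<Phi>"])
        (use p q(1) in \<open>auto\<close>)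
    have sum_w: "sum w T = 1" using w(2) sum1 by simp
    obtain \<mu> where \<mu>: "set_pmf \<mu> = {t\<in>T. w t \<noteq> 0}"
      "\<And>h. measure_pmf.expectation \<mu> h = (\<Sum>t\<in>T. w t * (h t :: real))"
      by (rule pmf_of_weights[OF finT w(1) sum_w], assumption) (rule that)
    have "path_prob M s \<Phi> \<le> measure_pmf.expectation \<mu> (\<lambda>t. path_prob M t \<Phi>)" if "\<Phi> \<in> D" for \<Phi>
    proof (cases "\<exists>\<xi>. \<Phi> = Globally \<xi> \<and> path_prob M s (Globally \<xi>) = 1")
      case True
      then have "path_prob M t \<Phi> = 1" if "t \<in> T" for t
        using that T s Globally_1_reachable by blast
      then have "(\<Sum>t\<in>T. w t * path_prob M t \<Phi>) = 1" using w(2) sum1 by simp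
      then show ?thesis by (simp add: \<mu>(2))
    next
      case False
      define W where "W = (\<Sum>t\<in>T. q t * path_prob M t \<Phi>)"
      have "path_prob M s \<Phi> \<le> W" using le[OF that False] by (simp add: W_def)
      also have "W \<le> W / p"
      proof -
        have "0 \<le> W" unfolding W_def using q(1) by (intro sum_nonneg mult_nonneg_nonneg) auto
        then show ?thesis using p by (simp add: le_divide_eq_1 pos_le_divide_eq mult_left_le)
      qed
      also have "W / p = measure_pmf.expectation \<mu> (\<lambda>t. path_prob M t \<Phi>)"
        using w(3)[OF that] by (simp add: \<mu>(2) W_def sum_divide_distrib)
      finally show ?thesis .
    qed
    with \<mu>(1) w(4) show ?thesis by (intro disjI2 exI[of _ \<mu>]) auto
  qed
qed

subsection \<open>Closure, update and norms\<close>

lemma sub_refl [simp]: "\<phi> \<in> sub \<phi>"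
  by (cases \<phi>) auto

lemma
  fixes \<phi> \<psi> :: "'a state_fm" and \<Phi> :: "'a path_fm"
  shows sub_trans: "\<psi> \<in> sub \<phi> \<Longrightarrow> sub \<psi> \<subseteq> sub \<phi>"
  and sub_path_trans: "\<psi> \<in> sub_path \<Phi> \<Longrightarrow> sub \<psi> \<subseteq> sub_path \<Phi>"
  by (induction \<phi> and \<Phi>) auto

lemma
  fixes \<phi> :: "'a state_fm" and \<Phi> :: "'a path_fm"
  shows finite_sub: "finite (sub \<phi>)" and finite_sub_path: "finite (sub_path \<Phi>)"
  by (induction \<phi> and \<Phi>) auto

lemma finite_subs: "finite X \<Longrightarrow> finite (subs X)"
  by (simp add: subs_def finite_sub)

lemma subset_subs: "X \<subseteq> subs X"
  by (auto simp: subs_def)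

lemma finite_psub: "finite X \<Longrightarrow> finite (psub X)"
proof -
  assume "finite X"
  have "psub X \<subseteq> (\<lambda>\<phi>. case \<phi> of Prob \<Phi> c r \<Rightarrow> \<Phi>) ` subs X"
    by (force simp: psub_def)
  then show ?thesis
    using finite_subs[OF \<open>finite X\<close>] finite_subset by blast
qed

lemma psub_mono_subs:
  assumes "Y \<subseteq> subs X"
  shows "psub Y \<subseteq> psub X"
proof -
  have "subs Y \<subseteq> subs X"
    using assms sub_trans unfolding subs_def by blast
  then show ?thesis unfolding psub_def by blast
qed

lemma subs_fragment: "pctl_fragment \<L> \<Longrightarrow> X \<subseteq> \<L> \<Longrightarrow> subs X \<subseteq> \<L>"
  by (auto simp: pctl_fragment_def subs_def)

lemma fragment_valid_bound: "pctl_fragment \<L> \<Longrightarrow> Prob \<Phi> c q \<in> \<L> \<Longrightarrow> valid_bound c q"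
  by (auto simp: pctl_fragment_def)

lemma fragment_change_bound:
  "pctl_fragment \<L> \<Longrightarrow> Prob \<Phi> c q \<in> \<L> \<Longrightarrow> valid_bound GE q' \<Longrightarrow> Prob \<Phi> GE q' \<in> \<L>"
  unfolding pctl_fragment_def by blast

section \<open>Closure and update sets\<close>

lemma sub_children:
  "Or \<phi> \<psi> \<in> sub \<zeta> \<Longrightarrow> \<phi> \<in> sub \<zeta> \<and> \<psi> \<in> sub \<zeta>"
  "And \<phi> \<psi> \<in> sub \<zeta> \<Longrightarrow> \<phi> \<in> sub \<zeta> \<and> \<psi> \<in> sub \<zeta>"
  "Prob (Finally \<phi>) c r \<in> sub \<zeta> \<Longrightarrow> \<phi> \<in> sub \<zeta>"
  by (drule sub_trans; auto)+

lemma closure_fm_sub: "z \<in> closure_fm M s \<psi> \<Longrightarrow> z \<in> sub \<psi>"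
  by (induction rule: closure_fm.induct) (auto dest: sub_children)

lemma closure_fm_sat: "z \<in> closure_fm M s \<psi> \<Longrightarrow> sat M \<psi> s \<Longrightarrow> sat M z s"
  by (induction rule: closure_fm.induct) auto

text \<open>The closure passes below a probability operator only through an eventuality whose
  argument already holds. This traces the origin of new formulae in the proof that the norm
  decreases.\<close>

lemma closure_fm_Prob:
  assumes "z \<in> closure_fm M s (Prob \<Phi> c r)"
  shows "z = Prob \<Phi> c r \<or> (\<exists>\<phi>. \<Phi> = Finally \<phi> \<and> sat M \<phi> s \<and> z \<in> sub \<phi>)"
  using assms by (induction rule: closure_fm.induct) (auto dest: sub_children)

lemma update_fm_idem [simp]: "update_fm M s (update_fm M s \<phi>) = update_fm M s \<phi>"
  by (cases \<phi>) auto

lemma update_fm_eq_simps [simp]: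
  "Or \<phi> \<psi> = update_fm M s z \<longleftrightarrow> z = Or \<phi> \<psi>"
  "And \<phi> \<psi> = update_fm M s z \<longleftrightarrow> z = And \<phi> \<psi>"
  by (cases z; auto)+

lemma Prob_eq_update_fm: "Prob \<Phi> c r = update_fm M s z \<Longrightarrow> \<exists>c' r'. z = Prob \<Phi> c' r'"
  by (cases z) auto

text \<open>An update changes only the bound of a \<open>Prob\<close> formula, and no closure rule
  inspects that bound.\<close>

lemma closure_fm_update:
  assumes "y \<in> closure_fm M s (update_fm M s z)"
  shows "y = update_fm M s z \<or> y \<in> closure_fm M s z"
  using assms
proof (induction rule: closure_fm.induct)
  case (or1 \<phi>1 \<phi>2)
  then show ?case by (auto intro: closure_fm.intros)
next
  case (or2 \<phi>1 \<phi>2)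
  then show ?case by (auto intro: closure_fm.intros)
next
  case (and1 \<phi>1 \<phi>2)
  then show ?case by (auto intro: closure_fm.intros)
next
  case (and2 \<phi>1 \<phi>2)
  then show ?case by (auto intro: closure_fm.intros)
next
  case (future \<phi> c r)
  from future.IH show ?case
  proof
    assume "Prob (Finally \<phi>) c r = update_fm M s z"
    then obtain c' r' where "z = Prob (Finally \<phi>) c' r'" by (blast dest: Prob_eq_update_fm)
    then show ?thesis using future.hyps by (auto intro: closure_fm.intros)
  qed (use future.hyps in \<open>auto intro: closure_fm.intros\<close>)
qed simp

lemma closure_fm_trans: "z \<in> closure_fm M s y \<Longrightarrow> y \<in> closure_fm M s \<psi> \<Longrightarrow> z \<in> closure_fm M s \<psi>"
  by (induction rule: closure_fm.induct) (auto intro: closure_fm.intros)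

lemma UC_base: "\<psi> \<in> Z \<Longrightarrow> update_fm M s \<psi> \<in> UC M s Z"
  by (auto simp: UC_def update_set_def closure_set_def intro: closure_fm.base)

text \<open>Closing an updated formula yields nothing new beyond the formula itself, and updates are
  idempotent. Hence every set \<open>UC M s Z\<close> meets the fixed-point hypothesis that progress
  loops require.\<close>

lemma UC_idem: "UC M s (UC M s Z) = UC M s Z"
proof (intro equalityI subsetI)
  fix x assume "x \<in> UC M s (UC M s Z)"
  then obtain \<psi> z y where "\<psi> \<in> Z" "z \<in> closure_fm M s \<psi>" "y \<in> closure_fm M s (update_fm M s z)"
    and x: "x = update_fm M s y"
    by (auto simp: UC_def update_set_def closure_set_def)
  then show "x \<in> UC M s Z"
    using closure_fm_update[of y M s z] closure_fm_trans[of y M s z \<psi>]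
    by (auto simp: UC_def update_set_def closure_set_def)
next
  fix x assume "x \<in> UC M s Z"
  moreover from this have "update_fm M s x = x"
    by (auto simp: UC_def update_set_def)
  ultimately show "x \<in> UC M s (UC M s Z)"
    using UC_base[of x "UC M s Z" M s] by simp
qed

lemma UC_cases:
  assumes "x \<in> UC M s Z"
  obtains \<psi> z where "\<psi> \<in> Z" "z \<in> closure_fm M s \<psi>" "x = update_fm M s z"
  using assms by (auto simp: UC_def update_set_def closure_set_def)

lemma finite_UC: "finite Z \<Longrightarrow> finite (UC M s Z)"
proof -
  assume "finite Z"
  have "closure_set M s Z \<subseteq> subs Z"
    using closure_fm_sub by (fastforce simp: closure_set_def subs_def)
  then show ?thesis
    using finite_subs[OF \<open>finite Z\<close>] by (auto simp: UC_def update_set_def intro: finite_subset)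
qed

lemma sat_update_fm: "sat M z s \<Longrightarrow> sat M (update_fm M s z) s"
  by (cases z) (auto simp: path_prob_def)

lemma UC_sat: "(\<And>\<psi>. \<psi> \<in> Z \<Longrightarrow> sat M \<psi> s) \<Longrightarrow> x \<in> UC M s Z \<Longrightarrow> sat M x s"
  by (erule UC_cases) (simp add: sat_update_fm closure_fm_sat)

lemma path_prob_pos:
  assumes "valid_bound c r" and "sat M (Prob \<Phi> c r) s"
  shows "0 < path_prob M s \<Phi>"
  using assms unfolding sat_Prob_iff by (cases c) auto

text \<open>A satisfied formula with an admissible bound has a path formula of positive probability,
  so the updated constraint never degenerates to \<open>\<ge> 0\<close>.\<close>

lemma UC_fragment:
  assumes frag: "pctl_fragment \<L>" and Z: "Z \<subseteq> \<L>" and sat: "\<And>\<psi>. \<psi> \<in> Z \<Longrightarrow> sat M \<psi> s"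
  shows "UC M s Z \<subseteq> \<L>"
proof
  fix x assume "x \<in> UC M s Z"
  then obtain \<psi> z where z: "\<psi> \<in> Z" "z \<in> closure_fm M s \<psi>" "x = update_fm M s z"
    by (rule UC_cases)
  have "\<psi> \<in> \<L>" "z \<in> sub \<psi>" using z closure_fm_sub Z by auto
  then have zL: "z \<in> \<L>"
    using subs_fragment[OF frag, of "{\<psi>}"] by (auto simp: subs_def)
  show "x \<in> \<L>"
  proof (cases "\<exists>\<Phi> c r. z = Prob \<Phi> c r")
    case True
    then obtain \<Phi> c r where zP: "z = Prob \<Phi> c r" by blast
    have "valid_bound c r"
      using zL unfolding zP by (rule fragment_valid_bound[OF frag])
    then have "0 < path_prob M s \<Phi>"
      using closure_fm_sat[OF z(2) sat[OF z(1)]] unfolding zP by (rule path_prob_pos)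
    then have "valid_bound GE (path_prob M s \<Phi>)" by simp
    then show ?thesis
      using zL unfolding z(3) zP update_fm.simps by (intro fragment_change_bound[OF frag])
  next
    case False
    then have "x = z" unfolding z(3) by (cases z) auto
    then show ?thesis using zL by simp
  qed
qed

text \<open>Updating may create formulae outside \<open>subs X\<close>, but only by changing a bound
  at top level; everything strictly below is inherited from \<open>X\<close>. This is why
  \<open>branching\<close> counts top-level probability formulae by their path formulae.\<close>

lemma UC_top_level:
  assumes Z: "\<forall>\<psi>\<in>Z. \<exists>\<Phi> c r c' r'. \<psi> = Prob \<Phi> c r \<and> Prob \<Phi> c' r' \<in> subs X"
    and y: "y \<in> UC M t Z"
  shows "y \<in> (\<Union>\<phi>\<in>X. sub \<phi> - {\<phi>}) \<or> (\<exists>\<Phi> c r c' r'. y = Prob \<Phi> c r \<and> Prob \<Phi> c' r' \<in> subs X)"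
    and "sub y - {y} \<subseteq> (\<Union>\<phi>\<in>X. sub \<phi> - {\<phi>})"
proof -
  obtain \<psi> z where z: "\<psi> \<in> Z" "z \<in> closure_fm M t \<psi>" "y = update_fm M t z"
    using y by (rule UC_cases)
  obtain \<Phi> c r c' r' x where \<psi>: "\<psi> = Prob \<Phi> c r" and x: "x \<in> X" "Prob \<Phi> c' r' \<in> sub x"
    using bspec[OF Z z(1)] by (auto simp: subs_def)
  \<comment> \<open>Any \<open>w\<close> below the operator of \<open>Prob \<Phi> c' r'\<close> is
    smaller in size than \<open>x\<close>, hence different from it.\<close>
  have strict: "w \<in> (\<Union>\<phi>\<in>X. sub \<phi> - {\<phi>})" if "w \<in> sub_path \<Phi>" for w
  proof -
    have "w \<in> sub x" using sub_trans[OF x(2)] that by auto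
    moreover have "size w < size x"
      using sub_size(2)[OF that] sub_size(1)[OF x(2)] by simp
    ultimately show ?thesis using x by auto
  qed
  have z_alt: "z = Prob \<Phi> c r \<or> z \<in> sub_path \<Phi>"
    using closure_fm_sub[OF z(2)] by (auto simp: \<psi>)
  show "y \<in> (\<Union>\<phi>\<in>X. sub \<phi> - {\<phi>}) \<or> (\<exists>\<Phi> c r c' r'. y = Prob \<Phi> c r \<and> Prob \<Phi> c' r' \<in> subs X)"
  proof (cases "\<exists>\<Psi> d p. z = Prob \<Psi> d p")
    case True
    then obtain \<Psi> d p where zP: "z = Prob \<Psi> d p" by blast
    from z_alt have "\<exists>c' r'. Prob \<Psi> c' r' \<in> subs X"
    proof
      assume "z = Prob \<Phi> c r"
      then show ?thesis using x zP by (auto simp: subs_def)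
    next
      assume "z \<in> sub_path \<Phi>"
      then show ?thesis using strict[of z] by (auto simp: subs_def zP)
    qed
    then show ?thesis using z(3) zP by auto
  next
    case False
    then have "y = z" "z \<in> sub_path \<Phi>" using z(3) z_alt by (cases z; auto)+
    then show ?thesis using strict by auto
  qed
  have "sub y - {y} \<subseteq> sub_path \<Phi>"
  proof (cases "\<exists>\<Psi> d p. z = Prob \<Psi> d p")
    case True
    then obtain \<Psi> d p where zP: "z = Prob \<Psi> d p" by blast
    then have "sub y - {y} \<subseteq> sub_path \<Psi>" using z(3) by auto
    also have "\<dots> \<subseteq> sub_path \<Phi>" using z_alt sub_path_trans[of z \<Phi>] by (auto simp: zP)
    finally show ?thesis .
  next
    case False
    then have "y = z" "z \<in> sub_path \<Phi>" using z(3) z_alt by (cases z; auto)+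
    then show ?thesis using sub_path_trans by blast
  qed
  then show "sub y - {y} \<subseteq> (\<Union>\<phi>\<in>X. sub \<phi> - {\<phi>})" using strict by auto
qed

lemma finite_strict_subs: "finite X \<Longrightarrow> finite (\<Union>\<phi>\<in>X. sub \<phi> - {\<phi>})"
  by (simp add: finite_sub)

lemma
  assumes Z: "\<forall>\<psi>\<in>Z. \<exists>\<Phi> c r c' r'. \<psi> = Prob \<Phi> c r \<and> Prob \<Phi> c' r' \<in> subs X"
  shows psub_UC: "psub (UC M t Z) \<subseteq> psub X"
    and branching_UC: "finite X \<Longrightarrow> branching (UC M t Z) \<le> branching X"
proof -
  let ?Y = "UC M t Z" and ?strict = "\<lambda>X. \<Union>\<phi>\<in>X. sub \<phi> - {\<phi>}"
  note top = UC_top_level[OF Z, of _ M t]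
  have strict: "?strict ?Y \<subseteq> ?strict X" using top(2) by (rule UN_least)
  have *: "y \<in> ?strict X \<or> (\<exists>\<Phi> c r c' r'. y = Prob \<Phi> c r \<and> Prob \<Phi> c' r' \<in> subs X)"
    if y: "y \<in> subs ?Y" for y
  proof -
    obtain \<phi> where \<phi>: "\<phi> \<in> ?Y" "y \<in> sub \<phi>" using y by (auto simp: subs_def)
    show ?thesis
    proof (cases "y = \<phi>")
      case True
      then show ?thesis using top(1)[OF \<phi>(1)] by simp
    next
      case False
      then show ?thesis using \<phi>(2) by (intro disjI1 subsetD[OF top(2)[OF \<phi>(1)]]) simp
    qed
  qed
  have sX: "?strict X \<subseteq> subs X" by (auto simp: subs_def)
  show psub: "psub ?Y \<subseteq> psub X"
  proof
    fix \<Phi> assume "\<Phi> \<in> psub ?Y"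
    then obtain c r where "Prob \<Phi> c r \<in> subs ?Y" by (auto simp: psub_def)
    from *[OF this] sX show "\<Phi> \<in> psub X" unfolding psub_def by blast
  qed
  have "nsub ?Y \<subseteq> nsub X"
    using * sX by (fastforce simp: nsub_def)
  moreover assume X: "finite X"
  from finite_subs[OF X] have "finite (nsub X)" by (simp add: nsub_def)
  ultimately show "branching ?Y \<le> branching X"
    unfolding branching_def
    using card_mono[OF finite_psub[OF X] psub] card_mono[OF finite_strict_subs[OF X] strict]
      card_mono[of "nsub X" "nsub ?Y"]
    by linarith
qed

text \<open>For a fixed point of \<open>UC\<close>, a \<open>Prob\<close> formula in
  \<open>X\<close> carries as bound the exact probability at \<open>s\<close>, so it is determined
  by its path formula. Every other subformula is counted by \<open>nsub\<close> or is a strict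
  one.\<close>

lemma card_subs_le:
  assumes X: "finite X" "X = UC M s X"
  shows "card (subs X) + 2 \<le> branching X"
proof -
  let ?strict = "\<Union>\<phi>\<in>X. sub \<phi> - {\<phi>}" and ?upd = "(\<lambda>\<Phi>. Prob \<Phi> GE (path_prob M s \<Phi>)) ` psub X"
  have "subs X \<subseteq> nsub X \<union> ?upd \<union> ?strict"
  proof
    fix \<phi> assume \<phi>: "\<phi> \<in> subs X"
    show "\<phi> \<in> nsub X \<union> ?upd \<union> ?strict"
    proof (cases "\<phi> \<in> X \<and> (\<exists>\<Phi> c r. \<phi> = Prob \<Phi> c r)")
      case True
      then have "\<phi> \<in> UC M s X" using equalityD1[OF X(2)] by blast
      then obtain z where z: "\<phi> = update_fm M s z" by (rule UC_cases)
      from True obtain \<Phi> c r where P: "\<phi> = Prob \<Phi> c r" by blast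
      then have "\<phi> = Prob \<Phi> GE (path_prob M s \<Phi>)" using z by (cases z) auto
      moreover have "\<Phi> \<in> psub X" using \<phi> P by (auto simp: psub_def)
      ultimately show ?thesis by auto
    next
      case False
      then show ?thesis using \<phi> by (auto simp: nsub_def subs_def)
    qed
  qed
  moreover have "finite (nsub X)" using finite_subs[OF X(1)] by (auto simp: nsub_def)
  ultimately have "card (subs X) \<le> card (nsub X \<union> ?upd \<union> ?strict)"
    using finite_psub[OF X(1)] finite_strict_subs[OF X(1)] by (intro card_mono finite_UnI finite_imageI)
  also have "\<dots> \<le> card (nsub X) + card ?upd + card ?strict"
    by (meson add_le_mono card_Un_le le_refl order_trans)
  also have "card ?upd \<le> card (psub X)"
    using finite_psub[OF X(1)] by (rule card_image_le)
  finally show ?thesis unfolding branching_def by linarith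
qed

lemma psub_fm_norm: "(\<Sum>\<Psi>\<in>psub {\<phi>}. path_norm \<Psi>) < path_norm (Finally \<phi>)"
  by simp

section \<open>Decrease of the norm at exit states\<close>

context finite_chain
begin

lemma cf_subset_psub: "cf M s Y \<subseteq> psub Y"
  using subset_subs[of Y] by (auto simp: cf_def psub_def)

lemma deg_subset_psub: "deg M s Y \<subseteq> psub Y"
  by (auto simp: deg_def)

text \<open>Each element of \<open>deg\<close> weighs 1 more than all path formulae of
  \<open>X\<close> together, so losing one outweighs any growth of \<open>cf\<close>.\<close>

lemma set_norm_less_deg:
  assumes X: "finite X" and psub: "psub Y \<subseteq> psub X" and deg: "deg M t Y \<subset> deg M s X"
  shows "set_norm M t Y < set_norm M s X"
proof -
  define A where "A = (\<Sum>\<Phi>\<in>psub X. path_norm \<Phi>)"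
  have fin_psub: "finite (psub X)" using finite_psub[OF X] .
  then have fin_Y: "finite (psub Y)" using psub finite_subset by blast
  have Y: "(\<Sum>\<Phi>\<in>psub Y. path_norm \<Phi>) \<le> A"
    unfolding A_def by (rule sum_mono2[OF fin_psub psub]) simp
  have cf: "(\<Sum>\<Phi>\<in>cf M t Y. path_norm \<Phi>) \<le> A"
    using order_trans[OF sum_mono2[OF fin_Y cf_subset_psub] Y] by simp
  have "Suc (card (deg M t Y)) \<le> card (deg M s X)"
    using psubset_card_mono[OF finite_subset[OF deg_subset_psub fin_psub] deg] by simp
  then have "Suc (card (deg M t Y)) * (1 + A) \<le> card (deg M s X) * (1 + A)"
    by (rule mult_le_mono1)
  moreover have "card (deg M t Y) * (1 + (\<Sum>\<Phi>\<in>psub Y. path_norm \<Phi>)) \<le> card (deg M t Y) * (1 + A)"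
    using Y by (intro mult_le_mono2) simp
  ultimately show ?thesis
    using cf unfolding set_norm_def A_def[symmetric] mult_Suc by linarith
qed

text \<open>Every fulfilled eventuality in \<open>H\<close> is traded for path formulae inside its
  argument, whose norms sum to less than its own. Overlaps between the sets
  \<open>psub {\<phi>}\<close> only lower the sum.\<close>

lemma set_norm_less_cf:
  assumes X: "finite X" and psub: "psub Y \<subseteq> psub X" and deg: "deg M t Y = deg M s X"
    and H: "H \<noteq> {}" "Finally ` H \<subseteq> cf M s X"
    and cf: "cf M t Y \<subseteq> (cf M s X - Finally ` H) \<union> (\<Union>\<phi>\<in>H. psub {\<phi>})"
  shows "set_norm M t Y < set_norm M s X"
proof -
  have fin_psub: "finite (psub X)" using finite_psub[OF X] .
  have fin_cf: "finite (cf M s X)" using finite_subset[OF cf_subset_psub fin_psub] .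
  then have fin_H: "finite H"
    using H(2) by (meson finite_imageD finite_subset inj_onI path_fm.inject(1))
  let ?n = "\<lambda>A. \<Sum>\<Phi>\<in>A. path_norm \<Phi>"
  have "?n (cf M t Y) \<le> ?n ((cf M s X - Finally ` H) \<union> (\<Union>\<phi>\<in>H. psub {\<phi>}))"
    using fin_cf fin_H finite_psub by (intro sum_mono2[OF _ cf]) auto
  also have "\<dots> \<le> ?n (cf M s X - Finally ` H) + ?n (\<Union>\<phi>\<in>H. psub {\<phi>})"
    by (subst sum.union_inter[symmetric]) (use fin_cf fin_H finite_psub in auto)
  also have "?n (\<Union>\<phi>\<in>H. psub {\<phi>}) \<le> (\<Sum>\<phi>\<in>H. ?n (psub {\<phi>}))"
    using fin_H by (induction H rule: finite_induct)
      (auto simp: finite_psub intro!: order_trans[OF eq_imp_le[OF sum_Un_nat]])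
  also have "\<dots> < (\<Sum>\<phi>\<in>H. path_norm (Finally \<phi>))"
    using fin_H H(1) by (intro sum_strict_mono psub_fm_norm)
  also have "\<dots> = ?n (Finally ` H)"
    by (subst sum.reindex) (auto simp: inj_on_def)
  also have "?n (cf M s X - Finally ` H) + ?n (Finally ` H) = ?n (cf M s X)"
    by (rule sum.subset_diff[OF H(2) fin_cf, symmetric])
  finally have "?n (cf M t Y) < ?n (cf M s X)" by simp
  moreover have "?n (psub Y) \<le> ?n (psub X)"
    by (rule sum_mono2[OF fin_psub psub]) simp
  then have "card (deg M s X) * (1 + ?n (psub Y)) \<le> card (deg M s X) * (1 + ?n (psub X))"
    by (intro mult_le_mono2) simp
  ultimately show ?thesis unfolding set_norm_def deg by linarith
qed

text \<open>The obligations handed to the submodel at \<open>t\<close>, with the exact probabilities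
  there as bounds. Path formulae of probability 0 are left out because \<open>\<ge> 0\<close> is not
  an admissible constraint.\<close>

definition residual :: "'s \<Rightarrow> 'a path_fm set \<Rightarrow> 'a state_fm set" where
  "residual t D = {Prob \<Phi> GE (path_prob M t \<Phi>) |\<Phi>. \<Phi> \<in> D \<and> 0 < path_prob M t \<Phi>}"

lemma residual_top_level: "D \<subseteq> psub X \<Longrightarrow> \<forall>\<psi>\<in>residual t D.
    \<exists>\<Phi> c r c' r'. \<psi> = Prob \<Phi> c r \<and> Prob \<Phi> c' r' \<in> subs X"
  by (auto simp: residual_def psub_def)

lemma residual_sat: "\<psi> \<in> residual t D \<Longrightarrow> sat M \<psi> t"
  by (auto simp: residual_def path_prob_def)

text \<open>Probability one of a \<open>Globally\<close> formula persists along transitions, so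
  \<open>deg\<close> cannot grow. If it does not shrink, no formula of \<open>deg M s X\<close> is
  certain at \<open>t\<close>; then \<open>boundary\<close> supplies a fulfilled eventuality and the
  \<open>cf\<close> part drops.\<close>

lemma set_norm_residual_less:
  assumes s: "s \<in> S" and t: "reachable M s t" and X: "finite X" and D: "D \<subseteq> psub X"
    and cf: "\<And>\<phi> u. Finally \<phi> \<in> D \<Longrightarrow> reachable M s u \<Longrightarrow> sat M \<phi> u \<Longrightarrow>
       (\<And>\<xi>. Globally \<xi> \<in> deg M s X \<Longrightarrow> \<not> sat M (Prob (Globally \<xi>) GE 1) u) \<Longrightarrow> Finally \<phi> \<in> cf M s X"
    and boundary: "(\<exists>\<xi>. Globally \<xi> \<in> deg M s X \<and> sat M (Prob (Globally \<xi>) GE 1) t) \<or>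
       (\<exists>\<phi>. Finally \<phi> \<in> D \<and> sat M \<phi> t)"
  shows "set_norm M t (UC M t (residual t D)) < set_norm M s X"
proof -
  let ?Y = "UC M t (residual t D)"
  have psub: "psub ?Y \<subseteq> psub X"
    by (rule psub_UC) (rule residual_top_level[OF D])
  have "deg M t ?Y \<subseteq> deg M s X"
  proof
    fix \<Phi> assume "\<Phi> \<in> deg M t ?Y"
    then obtain \<xi> where "\<Phi> = Globally \<xi>" "Globally \<xi> \<in> psub ?Y"
      "\<not> sat M (Prob (Globally \<xi>) GE 1) t"
      unfolding deg_def by blast
    then show "\<Phi> \<in> deg M s X"
      using psub Globally_1_reachable[OF t s] unfolding deg_def sat_Globally_1 by blast
  qed
  then consider "deg M t ?Y \<subset> deg M s X" | "deg M t ?Y = deg M s X" by blast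
  then show ?thesis
  proof cases
    case 1
    show ?thesis by (rule set_norm_less_deg[OF X psub 1])
  next
    case 2
    have t_deg: "\<not> sat M (Prob (Globally \<xi>) GE 1) t" if "Globally \<xi> \<in> deg M s X" for \<xi>
      using equalityD2[OF 2] that unfolding deg_def by blast
    define H where "H = {\<phi>. Finally \<phi> \<in> D \<and> sat M \<phi> t}"
    show ?thesis
    proof (rule set_norm_less_cf[OF X psub 2])
      show "H \<noteq> {}" using boundary t_deg by (auto simp: H_def)
      show "Finally ` H \<subseteq> cf M s X" using cf[OF _ t _ t_deg] by (auto simp: H_def)
      show "cf M t ?Y \<subseteq> (cf M s X - Finally ` H) \<union> (\<Union>\<phi>\<in>H. psub {\<phi>})"
      proof
        fix \<Phi> assume "\<Phi> \<in> cf M t ?Y"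
        then obtain \<phi> c r u where \<phi>: "\<Phi> = Finally \<phi>" "Prob (Finally \<phi>) c r \<in> ?Y" "\<not> sat M \<phi> t"
          and u: "reachable M t u" "sat M \<phi> u"
            "\<And>\<xi>. Globally \<xi> \<in> deg M t ?Y \<Longrightarrow> \<not> sat M (Prob (Globally \<xi>) GE 1) u"
          unfolding cf_def by blast
        from \<phi>(2) obtain \<psi> z where z: "\<psi> \<in> residual t D" "z \<in> closure_fm M t \<psi>"
          "Prob (Finally \<phi>) c r = update_fm M t z"
          by (rule UC_cases)
        then obtain c' r' where z': "z = Prob (Finally \<phi>) c' r'" by (blast dest: Prob_eq_update_fm)
        obtain \<Psi> p where \<Psi>: "\<psi> = Prob \<Psi> GE p" "\<Psi> \<in> D" using z(1) by (auto simp: residual_def)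
        from closure_fm_Prob[OF z(2)[unfolded \<Psi>(1)]]
        show "\<Phi> \<in> (cf M s X - Finally ` H) \<union> (\<Union>\<phi>\<in>H. psub {\<phi>})"
        proof
          \<comment> \<open>An obligation that was already pending: its witness \<open>u\<close> is
            reachable from \<open>s\<close> as well, and it is not in \<open>H\<close> because
            \<open>\<phi>\<close> fails at \<open>t\<close>.\<close>
          assume "z = Prob \<Psi> GE p"
          then have "Finally \<phi> \<in> D" using z' \<Psi> by simp
          then have "Finally \<phi> \<in> cf M s X"
            using u(2,3) reachable_trans[OF t u(1)] unfolding 2 by (rule_tac cf) auto
          moreover have "\<phi> \<notin> H" using \<phi>(3) by (simp add: H_def)
          ultimately show ?thesis using \<phi>(1) by auto
        next
          \<comment> \<open>A new obligation, uncovered by closing under a fulfilled eventuality; it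
            lies inside the argument \<open>\<zeta>\<close>.\<close>
          assume "\<exists>\<zeta>. \<Psi> = Finally \<zeta> \<and> sat M \<zeta> t \<and> z \<in> sub \<zeta>"
          then obtain \<zeta> where "\<zeta> \<in> H" "z \<in> sub \<zeta>" using \<Psi> by (auto simp: H_def)
          then show ?thesis using \<phi>(1) z' by (auto simp: psub_def subs_def)
        qed
      qed
    qed
  qed
qed

end

subsection \<open>The loop model\<close>

text \<open>State \<open>(0, i)\<close> is the \<open>i\<close>-th state of the loop; \<open>(Suc t, x)\<close> is the copy of state \<open>x\<close> of the
  chain \<open>N t\<close>. Only the last loop state leaves the loop, with probability \<open>\<epsilon>\<close>.\<close>

definition loop_chain :: "nat \<Rightarrow> (nat \<Rightarrow> 'a state_fm set) \<Rightarrow> real \<Rightarrow> nat pmf \<Rightarrow> nat set \<Rightarrow>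
    (nat \<Rightarrow> (nat, 'a) markov_chain) \<Rightarrow> (nat \<Rightarrow> nat) \<Rightarrow> (nat \<times> nat, 'a) markov_chain" where
  "loop_chain n L \<epsilon> \<mu> T N r =
    \<lparr>states = {0} \<times> {..n} \<union> (\<Union>t\<in>T. {Suc t} \<times> states (N t)),
     trans = (\<lambda>(k, x). case k of
         0 \<Rightarrow> if x < n then return_pmf (0, Suc x)
              else bind_pmf (bernoulli_pmf \<epsilon>)
                (\<lambda>b. if b then map_pmf (\<lambda>t. (Suc t, r t)) \<mu> else return_pmf (0, 0))
       | Suc t \<Rightarrow> map_pmf (Pair (Suc t)) (trans (N t) x)),
     val = (\<lambda>(k, x). case k of 0 \<Rightarrow> {a. Prop a \<in> L x} | Suc t \<Rightarrow> val (N t) x)\<rparr>"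

text \<open>The value \<open>\<epsilon> = 0\<close> is allowed and describes a cycle that is never
  left; \<open>\<mu>\<close> is then a dummy, so its support is constrained only for positive
  \<open>\<epsilon>\<close>.\<close>

locale loop_model =
  fixes n :: nat and L :: "nat \<Rightarrow> 'a state_fm set" and \<epsilon> :: real and \<mu> :: "nat pmf"
    and T :: "nat set" and N :: "nat \<Rightarrow> (nat, 'a) markov_chain" and r :: "nat \<Rightarrow> nat"
  assumes T: "finite T" and N: "\<And>t. t \<in> T \<Longrightarrow> finite_chain (N t)"
    and r: "\<And>t. t \<in> T \<Longrightarrow> r t \<in> states (N t)"
    and \<epsilon>: "0 \<le> \<epsilon>" "\<epsilon> < 1" and \<mu>: "finite (set_pmf \<mu>)" "0 < \<epsilon> \<Longrightarrow> set_pmf \<mu> \<subseteq> T"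
begin

definition M' :: "(nat \<times> nat, 'a) markov_chain" where "M' = loop_chain n L \<epsilon> \<mu> T N r"

lemma states_M': "states M' = {0} \<times> {..n} \<union> (\<Union>t\<in>T. {Suc t} \<times> states (N t))"
  by (simp add: M'_def loop_chain_def)

lemma trans_loop: "i < n \<Longrightarrow> trans M' (0, i) = return_pmf (0, Suc i)"
  by (simp add: M'_def loop_chain_def)

lemma trans_exit: "trans M' (0, n) = bind_pmf (bernoulli_pmf \<epsilon>)
    (\<lambda>b. if b then map_pmf (\<lambda>t. (Suc t, r t)) \<mu> else return_pmf (0, 0))"
  by (simp add: M'_def loop_chain_def)

lemma trans_copy: "trans M' (Suc t, x) = map_pmf (Pair (Suc t)) (trans (N t) x)"
  by (simp add: M'_def loop_chain_def)

lemma val_M': "val M' (0, i) = {a. Prop a \<in> L i}" "val M' (Suc t, x) = val (N t) x"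
  by (simp_all add: M'_def loop_chain_def)

lemma set_trans_exit: "set_pmf (trans M' (0, n)) \<subseteq> {(0, 0)} \<union> (if \<epsilon> = 0 then {} else (\<lambda>t. (Suc t, r t)) ` T)"
proof (cases "\<epsilon> = 0")
  case True
  then have "set_pmf (bernoulli_pmf \<epsilon>) \<subseteq> {False}"
    by (auto simp: set_pmf_iff)
  then have "set_pmf (trans M' (0, n)) \<subseteq> (\<Union>b\<in>{False}. set_pmf
      (if b then map_pmf (\<lambda>t. (Suc t, r t)) \<mu> else return_pmf (0, 0)))"
    unfolding trans_exit set_bind_pmf by (intro UN_mono subset_refl)
  then show ?thesis unfolding if_P[OF True] by simp
next
  case False
  then have "set_pmf \<mu> \<subseteq> T" using \<epsilon> \<mu> by simp
  then have "(\<lambda>t. (Suc t, r t)) ` set_pmf \<mu> \<subseteq> (\<lambda>t. (Suc t, r t)) ` T" by (rule image_mono)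
  then have "set_pmf (if b then map_pmf (\<lambda>t. (Suc t, r t)) \<mu> else return_pmf (0, 0))
      \<subseteq> {(0, 0)} \<union> (\<lambda>t. (Suc t, r t)) ` T" for b
    by (cases b) (simp_all add: subset_insertI2)
  then show ?thesis
    unfolding trans_exit set_bind_pmf if_not_P[OF False] by (intro UN_least)
qed

lemma finite_chain_M': "finite_chain M'"
proof
  have fin_N: "finite (states (N t))" and N_closed: "x \<in> states (N t) \<Longrightarrow> set_pmf (trans (N t) x) \<subseteq> states (N t)"
    if "t \<in> T" for t x
    using N[OF that] by (auto dest: finite_chain.fin finite_chain.succ_closed)
  show fin: "finite (states M')"
    unfolding states_M' using T fin_N by auto
  have "set_pmf (trans M' u) \<subseteq> states M'" if u: "u \<in> states M'" for u
  proof -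
    consider i where "u = (0, i)" "i < n" | "u = (0, n)"
      | t x where "u = (Suc t, x)" "t \<in> T" "x \<in> states (N t)"
      using u by (auto simp: states_M' le_less)
    then show ?thesis
    proof cases
      case 1
      then show ?thesis by (auto simp: trans_loop states_M')
    next
      case 2
      have "set_pmf (trans M' u) \<subseteq> {(0, 0)} \<union> (\<lambda>t. (Suc t, r t)) ` T"
        using set_trans_exit by (auto simp: 2 split: if_splits)
      also have "\<dots> \<subseteq> states M'" using r by (auto simp: states_M')
      finally show ?thesis .
    next
      case 3
      have "set_pmf (trans M' u) = Pair (Suc t) ` set_pmf (trans (N t) x)"
        by (simp add: 3(1) trans_copy)
      also have "\<dots> \<subseteq> Pair (Suc t) ` states (N t)"
        using N_closed[OF 3(2,3)] by (rule image_mono)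
      also have "\<dots> \<subseteq> states M'" using 3(2) by (auto simp: states_M')
      finally show ?thesis .
    qed
  qed
  with fin show "is_markov_chain M'"
    by (auto simp: is_markov_chain_def intro: countable_finite)
qed

sublocale M': finite_chain M'
  by (rule finite_chain_M')

lemma loop_state: "i \<le> n \<Longrightarrow> (0, i) \<in> states M'"
  by (simp add: states_M')

lemma E_loop: "i < n \<Longrightarrow> M'.E (0, i) h = h (0, Suc i)"
  by (simp add: trans_loop)

lemma E_exit: "M'.E (0, n) h =
    (1 - \<epsilon>) * h (0, 0) + \<epsilon> * measure_pmf.expectation \<mu> (\<lambda>t. h (Suc t, r t))"
proof -
  have "M'.E (0, n) h = (\<Sum>b\<in>UNIV. pmf (bernoulli_pmf \<epsilon>) b *\<^sub>R
     measure_pmf.expectation (if b then map_pmf (\<lambda>t. (Suc t, r t)) \<mu> else return_pmf (0, 0)) h)"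
    unfolding trans_exit using \<mu>(1) by (intro pmf_expectation_bind) auto
  then show ?thesis using \<epsilon> by (simp add: UNIV_bool)
qed

lemma path_prob_copy:
  assumes "t \<in> T" "x \<in> states (N t)"
  shows "path_prob M' (Suc t, x) \<Phi> = path_prob (N t) x \<Phi>"
proof (rule path_prob_morphism[where f = "Pair (Suc t)"])
  show "finite_chain (N t)" by (rule N) fact
  show "Pair (Suc t) ` states (N t) \<subseteq> states M'" using assms by (auto simp: states_M')
qed (use assms finite_chain_M' in \<open>auto simp: trans_copy val_M'\<close>)

definition exit_prob :: "'a path_fm \<Rightarrow> real" where
  "exit_prob \<Phi> = measure_pmf.expectation \<mu> (\<lambda>t. path_prob (N t) (r t) \<Phi>)"

lemma E_exit_path_prob:
  "M'.E (0, n) (\<lambda>u. path_prob M' u \<Phi>) = (1 - \<epsilon>) * path_prob M' (0, 0) \<Phi> + \<epsilon> * exit_prob \<Phi>"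
proof (cases "\<epsilon> = 0")
  case True
  then show ?thesis unfolding E_exit by simp
next
  case False
  then have \<mu>T: "set_pmf \<mu> \<subseteq> T" using \<epsilon> \<mu> by simp
  have "measure_pmf.expectation \<mu> (\<lambda>t. path_prob M' (Suc t, r t) \<Phi>) = exit_prob \<Phi>"
    unfolding exit_prob_def using \<mu>T r
    by (intro integral_cong_AE) (auto simp: AE_measure_pmf_iff path_prob_copy)
  then show ?thesis by (simp add: E_exit)
qed

lemma exit_prob_le_1: "exit_prob \<Phi> \<le> 1"
proof -
  have "exit_prob \<Phi> \<le> measure_pmf.expectation \<mu> (\<lambda>_. 1)"
    unfolding exit_prob_def
    by (intro integral_mono integrable_measure_pmf_finite \<mu>(1)) auto
  then show ?thesis by simp
qed

section \<open>Probabilities at the loop states\<close>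

lemma Finally_antimono_loop:
  assumes "i \<le> j" "j \<le> n"
  shows "path_prob M' (0, j) (Finally \<phi>) \<le> path_prob M' (0, i) (Finally \<phi>)"
  using assms
proof (induction j rule: dec_induct)
  case (step j)
  have "path_prob M' (0, Suc j) (Finally \<phi>) \<le> path_prob M' (0, j) (Finally \<phi>)"
    using step M'.path_prob_Finally_step[OF loop_state, of j \<phi>] by (simp add: E_loop)
  with step show ?case by simp
qed simp

lemma Finally_loop_later:
  assumes "i \<le> j" "j \<le> n" "sat M' \<phi> (0, j)"
  shows "path_prob M' (0, i) (Finally \<phi>) = 1"
proof (rule antisym[OF path_prob_le_1])
  have "path_prob M' (0, j) (Finally \<phi>) = 1"
    by (subst M'.path_prob_Finally_step[OF loop_state[OF assms(2)]]) (simp add: assms(3))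
  then show "1 \<le> path_prob M' (0, i) (Finally \<phi>)"
    using Finally_antimono_loop[OF assms(1,2), of \<phi>] by simp
qed

text \<open>The one-step equation at the last loop state gives equality, except when
  \<open>\<phi>\<close> holds there; in that case the right-hand side is 1.\<close>

lemma Finally_exit: "(1 - \<epsilon>) * path_prob M' (0, 0) (Finally \<phi>) + \<epsilon> * exit_prob (Finally \<phi>)
    \<le> path_prob M' (0, n) (Finally \<phi>)"
proof -
  have "(1 - \<epsilon>) * path_prob M' (0, 0) (Finally \<phi>) + \<epsilon> * exit_prob (Finally \<phi>) \<le> (1 - \<epsilon>) * 1 + \<epsilon> * 1"
    using \<epsilon> exit_prob_le_1 by (intro add_mono mult_left_mono) auto
  then show ?thesis
    using M'.path_prob_Finally_step[OF loop_state, of n \<phi>] by (simp add: E_exit_path_prob)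
qed

text \<open>With probability at least \<open>1 - \<epsilon>\<close> the run returns to the start of
  the cycle before leaving, and from there it certainly passes \<open>j\<close>.\<close>

lemma Finally_loop_anywhere:
  assumes "i \<le> n" "j \<le> n" "sat M' \<phi> (0, j)"
  shows "1 - \<epsilon> \<le> path_prob M' (0, i) (Finally \<phi>)"
proof -
  have "path_prob M' (0, 0) (Finally \<phi>) = 1"
    using Finally_loop_later[of 0 j \<phi>] assms by simp
  moreover have "0 \<le> \<epsilon> * exit_prob (Finally \<phi>)"
    unfolding exit_prob_def using \<epsilon> by (intro mult_nonneg_nonneg integral_nonneg) auto
  ultimately have "1 - \<epsilon> \<le> path_prob M' (0, n) (Finally \<phi>)"
    using Finally_exit[of \<phi>] by simp
  also have "\<dots> \<le> path_prob M' (0, i) (Finally \<phi>)"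
    using assms by (intro Finally_antimono_loop) auto
  finally show ?thesis .
qed

text \<open>Monotonicity along the cycle turns \<open>Finally_exit\<close> into a lower bound at the
  start of the cycle; inserting it once more makes the value at \<open>n\<close> at least a convex
  combination of two copies of the exit average.\<close>

lemma Finally_ge_exit_prob:
  assumes "i \<le> n" "0 < \<epsilon>"
  shows "exit_prob (Finally \<phi>) \<le> path_prob M' (0, i) (Finally \<phi>)"
proof -
  let ?f = "\<lambda>i. path_prob M' (0, i) (Finally \<phi>)" and ?y = "exit_prob (Finally \<phi>)"
  have "?f n \<le> ?f 0" by (intro Finally_antimono_loop) auto
  with Finally_exit[of \<phi>] have "\<epsilon> * ?y \<le> \<epsilon> * ?f 0" by (simp add: left_diff_distrib)
  then have y: "?y \<le> ?f 0" using assms by simp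
  have "?y = (1 - \<epsilon>) * ?y + \<epsilon> * ?y" by (simp add: left_diff_distrib)
  also have "\<dots> \<le> (1 - \<epsilon>) * ?f 0 + \<epsilon> * ?y"
    using y \<epsilon> by (intro add_right_mono mult_left_mono) auto
  also have "\<dots> \<le> ?f n" by (rule Finally_exit)
  also have "\<dots> \<le> ?f i" using assms by (intro Finally_antimono_loop) auto
  finally show ?thesis .
qed

lemma Globally_no_exit:
  assumes "i \<le> n" "\<epsilon> = 0" "\<And>j. j \<le> n \<Longrightarrow> sat M' \<phi> (0, j)"
  shows "path_prob M' (0, i) (Globally \<phi>) = 1"
  unfolding path_prob_Globally
proof (rule M'.stay_closed[of "{0} \<times> {..n}"])
  show "set_pmf (trans M' u) \<subseteq> {0} \<times> {..n}" if "u \<in> {0} \<times> {..n}" for u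
  proof -
    from that obtain i where i: "u = (0, i)" "i \<le> n" by auto
    show ?thesis
    proof (cases "i < n")
      case True
      then show ?thesis by (simp add: i trans_loop)
    next
      case False
      then have "u = (0, n)" using i by simp
      then show ?thesis using set_trans_exit unfolding if_P[OF assms(2)] by auto
    qed
  qed
qed (use assms(1,3) in \<open>auto simp: states_M'\<close>)

text \<open>All loop states share one value \<open>g\<close>, and the step out of the last state
  reads \<open>g = (1 - \<epsilon>) * g + \<epsilon> * y\<close> with \<open>y\<close> the exit
  average. As \<open>\<epsilon>\<close> is positive, \<open>g = y\<close>.\<close>

lemma Globally_eq_exit_prob:
  assumes "i \<le> n" "0 < \<epsilon>" and sat: "\<And>j. j \<le> n \<Longrightarrow> sat M' \<phi> (0, j)"
  shows "path_prob M' (0, i) (Globally \<phi>) = exit_prob (Globally \<phi>)"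
proof -
  let ?g = "\<lambda>i. path_prob M' (0, i) (Globally \<phi>)" and ?y = "exit_prob (Globally \<phi>)"
  have eq: "?g j = ?g 0" if "j \<le> n" for j
    using that
  proof (induction j)
    case (Suc j)
    then have "?g j = ?g (Suc j)"
      using M'.path_prob_Globally_step[OF loop_state, of j \<phi>] sat[of j] by (simp add: E_loop)
    with Suc show ?case by simp
  qed simp
  have "?g n = (1 - \<epsilon>) * ?g 0 + \<epsilon> * ?y"
    using M'.path_prob_Globally_step[OF loop_state, of n \<phi>] sat[of n] by (simp add: E_exit_path_prob)
  then have "\<epsilon> * ?g 0 = \<epsilon> * ?y" using eq[of n] by (auto simp: left_diff_distrib)
  then show ?thesis using eq[OF assms(1)] assms(2) by simp
qed

text \<open>Induction on size. Membership in \<open>loop_delta\<close> tells which obligations rest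
  on the exit distribution; the remaining eventualities are met on the cycle, where bound 1 and
  bounds below 1 need different arguments.\<close>

lemma sat_loop:
  assumes lit: "\<And>i a. i \<le> n \<Longrightarrow> Prop a \<in> L i \<Longrightarrow> NProp a \<notin> L i"
    and conj: "\<And>i \<phi> \<psi>. i \<le> n \<Longrightarrow> And \<phi> \<psi> \<in> L i \<Longrightarrow> \<phi> \<in> L i \<and> \<psi> \<in> L i"
    and disj: "\<And>i \<phi> \<psi>. i \<le> n \<Longrightarrow> Or \<phi> \<psi> \<in> L i \<Longrightarrow> \<phi> \<in> L i \<or> \<psi> \<in> L i"
    and glob: "\<And>i j \<phi> c q. i \<le> n \<Longrightarrow> j \<le> n \<Longrightarrow> Prob (Globally \<phi>) c q \<in> L i \<Longrightarrow> \<phi> \<in> L j"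
    and bound: "\<And>i \<Phi> c q. i \<le> n \<Longrightarrow> Prob \<Phi> c q \<in> L i \<Longrightarrow> valid_bound c q"
    and small: "\<And>i \<Phi> c q. i \<le> n \<Longrightarrow> Prob \<Phi> c q \<in> L i \<Longrightarrow> q < 1 \<Longrightarrow> q < 1 - \<epsilon>"
    and exit: "\<And>\<Phi> c q. 0 < \<epsilon> \<Longrightarrow> Prob \<Phi> c q \<in> loop_delta n L \<Longrightarrow> holds c (exit_prob \<Phi>) q"
    and no_exit: "\<And>\<Phi> c q. \<epsilon> = 0 \<Longrightarrow> Prob \<Phi> c q \<in> loop_delta n L \<Longrightarrow> \<exists>\<xi>. \<Phi> = Globally \<xi>"
  shows "i \<le> n \<Longrightarrow> \<phi> \<in> L i \<Longrightarrow> sat M' \<phi> (0, i)"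
proof (induction "size \<phi>" arbitrary: \<phi> i rule: less_induct)
  case less
  note i = less.prems(1)
  have holds_mono: "holds c p q \<Longrightarrow> p \<le> p' \<Longrightarrow> holds c p' q" for c p p' q
    by (cases c) auto
  have holds_1: "valid_bound c q \<Longrightarrow> holds c 1 q" for c q
    by (cases c) auto
  show ?case
  proof (cases \<phi>)
    case (Prop a)
    then show ?thesis using less.prems by (simp add: val_M')
  next
    case (NProp a)
    then show ?thesis using less.prems lit by (auto simp: val_M')
  next
    case (And \<psi> \<psi>')
    then show ?thesis using less conj[of i \<psi> \<psi>'] by simp
  next
    case (Or \<psi> \<psi>')
    then show ?thesis using less disj[of i \<psi> \<psi>'] by auto
  next
    case (Prob \<Phi> c q)
    have valid: "valid_bound c q" using bound less.prems Prob by blast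
    show ?thesis
    proof (cases \<Phi>)
      case (Finally \<zeta>)
      show ?thesis
      proof (cases "\<phi> \<in> loop_delta n L")
        case True
        have "0 < \<epsilon>"
        proof (rule ccontr)
          assume "\<not> 0 < \<epsilon>"
          then have "\<epsilon> = 0" using \<epsilon> by simp
          with no_exit[of \<Phi> c q] True Prob Finally show False by auto
        qed
        then show ?thesis
          using exit[of \<Phi> c q] True Prob Finally Finally_ge_exit_prob[OF i, of \<zeta>] holds_mono
          unfolding Prob sat_Prob_iff by blast
      next
        case False
        have \<phi>: "Prob (Finally \<zeta>) c q \<in> L i" using less.prems Prob Finally by simp
        then have "\<zeta> \<in> (\<Union>j\<le>n. L j)"
          using False i unfolding loop_delta_def Prob Finally by blast
        then obtain j where j: "j \<le> n" "\<zeta> \<in> L j" by auto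
        have sat_\<zeta>: "sat M' \<zeta> (0, k)" if "k \<le> n" "\<zeta> \<in> L k" for k
          using that less.hyps[of \<zeta> k] by (simp add: Prob Finally)
        show ?thesis
        proof (cases "c = GE \<and> q = 1")
          case True
          \<comment> \<open>Only the last loop state has an exit, so a goal between \<open>i\<close>
            and \<open>n\<close> is reached with certainty, whereas an earlier one would require a
            full round.\<close>
          then have "\<zeta> \<in> (\<Union>j\<in>{i..n}. L j)"
            using False i \<phi> unfolding loop_delta_def Prob Finally by blast
          then obtain k where "i \<le> k" "k \<le> n" "\<zeta> \<in> L k" by auto
          then have "path_prob M' (0, i) (Finally \<zeta>) = 1"
            using sat_\<zeta> by (intro Finally_loop_later) auto
          then show ?thesis unfolding Prob Finally sat_Prob_iff using holds_1[OF valid] by simp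
        next
          case False
          \<comment> \<open>The constraint \<open>> 1\<close> is inadmissible, so every bound other
            than \<open>\<ge> 1\<close> lies strictly below 1 and tolerates the loss of
            \<open>\<epsilon>\<close>.\<close>
          then have "q < 1" using valid by (cases c) auto
          then have "q < 1 - \<epsilon>" using small[OF i \<phi>] by simp
          also have "\<dots> \<le> path_prob M' (0, i) (Finally \<zeta>)"
            by (rule Finally_loop_anywhere[OF i j(1) sat_\<zeta>[OF j]])
          finally show ?thesis unfolding Prob Finally sat_Prob_iff by (cases c) auto
        qed
      qed
    next
      case (Globally \<xi>)
      have \<phi>: "Prob (Globally \<xi>) c q \<in> L i" using less.prems Prob Globally by simp
      then have delta: "Prob (Globally \<xi>) c q \<in> loop_delta n L"
        using i unfolding loop_delta_def by blast
      have sat_\<xi>: "sat M' \<xi> (0, j)" if "j \<le> n" for j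
        using that less.hyps[of \<xi> j] glob[OF i that \<phi>] by (simp add: Prob Globally)
      show ?thesis
      proof (cases "\<epsilon> = 0")
        case True
        show ?thesis
          unfolding Prob Globally sat_Prob_iff
          using Globally_no_exit[OF i True sat_\<xi>] holds_1[OF valid] by simp
      next
        case False
        then have "0 < \<epsilon>" using \<epsilon> by simp
        then show ?thesis
          unfolding Prob Globally sat_Prob_iff
          using Globally_eq_exit_prob[OF i _ sat_\<xi>] exit[OF _ delta] by simp
      qed
    qed
  qed
qed

end

subsection \<open>Relabelling states\<close>

text \<open>\<open>inv_into\<close> recovers the original state, so this is an isomorphic copy when
  \<open>f\<close> is injective on the states; transitions and labels outside the image are
  arbitrary.\<close>

definition relabel :: "('s \<Rightarrow> 't) \<Rightarrow> ('s, 'a) markov_chain \<Rightarrow> ('t, 'a) markov_chain" where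
  "relabel f M = \<lparr>states = f ` states M,
     trans = (\<lambda>x. map_pmf f (trans M (inv_into (states M) f x))),
     val = (\<lambda>x. val M (inv_into (states M) f x))\<rparr>"

context finite_chain
begin

context
  fixes f :: "'s \<Rightarrow> 't"
  assumes inj: "inj_on f S"
begin

lemma states_relabel: "states (relabel f M) = f ` S"
  by (simp add: relabel_def)

lemma trans_relabel: "u \<in> S \<Longrightarrow> trans (relabel f M) (f u) = map_pmf f (trans M u)"
  by (simp add: relabel_def inj)

lemma val_relabel: "u \<in> S \<Longrightarrow> val (relabel f M) (f u) = val M u"
  by (simp add: relabel_def inj)

lemma finite_chain_relabel: "finite_chain (relabel f M)"
proof
  show "finite (states (relabel f M))" using fin by (simp add: states_relabel)
  moreover have "set_pmf (trans (relabel f M) x) \<subseteq> f ` S" if "x \<in> f ` S" for x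
  proof -
    from that obtain u where u: "u \<in> S" "x = f u" by blast
    show ?thesis using image_mono[OF succ_closed[OF u(1)], of f] u by (simp add: trans_relabel)
  qed
  ultimately show "is_markov_chain (relabel f M)"
    by (auto simp: is_markov_chain_def states_relabel intro: countable_finite)
qed

lemmas relabel_morphism_assms = finite_chain_axioms finite_chain_relabel
  equalityD2[OF states_relabel] trans_relabel val_relabel

lemma sat_relabel: "u \<in> S \<Longrightarrow> sat (relabel f M) \<phi> (f u) \<longleftrightarrow> sat M \<phi> u"
  by (rule sat_morphism[OF relabel_morphism_assms])

lemma path_prob_relabel: "u \<in> S \<Longrightarrow> path_prob (relabel f M) (f u) \<Phi> = path_prob M u \<Phi>"
  by (rule path_prob_morphism[OF relabel_morphism_assms])

lemma reachable_relabelI: "reachable M s u \<Longrightarrow> s \<in> S \<Longrightarrow> reachable (relabel f M) (f s) (f u)"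
proof (induction rule: reachable_induct)
  case (step t u)
  then have "f u \<in> set_pmf (trans (relabel f M) (f t))"
    using reachable_states by (simp add: trans_relabel)
  then show ?case using step reachable_succ by fast
qed simp

lemma reachable_relabelD:
  "reachable (relabel f M) (f s) x \<Longrightarrow> s \<in> S \<Longrightarrow> \<exists>u. x = f u \<and> reachable M s u"
proof (induction rule: reachable_induct)
  case (step t x)
  then obtain u where u: "t = f u" "reachable M s u" by blast
  then have "u \<in> S" using step.prems reachable_states by blast
  then obtain v where "x = f v" "v \<in> set_pmf (trans M u)"
    using step.hyps u by (auto simp: trans_relabel)
  then show ?case using u reachable_succ by fast
qed (use reachable_refl in fast)

lemma closure_fm_relabel:
  assumes s: "s \<in> S"
  shows "closure_fm (relabel f M) (f s) \<psi> = closure_fm M s \<psi>"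
proof (intro equalityI subsetI)
  fix z assume "z \<in> closure_fm (relabel f M) (f s) \<psi>"
  then show "z \<in> closure_fm M s \<psi>"
    by (induction rule: closure_fm.induct) (auto simp: sat_relabel[OF s] intro: closure_fm.intros)
next
  fix z assume "z \<in> closure_fm M s \<psi>"
  then show "z \<in> closure_fm (relabel f M) (f s) \<psi>"
    by (induction rule: closure_fm.induct) (auto simp: sat_relabel[OF s] intro: closure_fm.intros)
qed

lemma UC_relabel:
  assumes s: "s \<in> S"
  shows "UC (relabel f M) (f s) X = UC M s X"
proof -
  have "update_fm (relabel f M) (f s) \<phi> = update_fm M s \<phi>" for \<phi>
    by (cases \<phi>) (simp_all add: path_prob_relabel s)
  then show ?thesis
    by (simp add: UC_def update_set_def closure_set_def closure_fm_relabel[OF s])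
qed

lemma deg_relabel: "s \<in> S \<Longrightarrow> deg (relabel f M) (f s) X = deg M s X"
  unfolding deg_def by (simp only: sat_relabel)

lemma cf_relabel:
  assumes s: "s \<in> S"
  shows "cf (relabel f M) (f s) X = cf M s X"
proof -
  have "(\<exists>x. reachable (relabel f M) (f s) x \<and> sat (relabel f M) \<phi> x \<and>
        (\<forall>\<xi>. Globally \<xi> \<in> deg M s X \<longrightarrow> \<not> sat (relabel f M) (Prob (Globally \<xi>) GE 1) x)) \<longleftrightarrow>
      (\<exists>u. reachable M s u \<and> sat M \<phi> u \<and>
        (\<forall>\<xi>. Globally \<xi> \<in> deg M s X \<longrightarrow> \<not> sat M (Prob (Globally \<xi>) GE 1) u))" (is "?L = ?R") for \<phi>
  proof
    assume ?L
    then obtain x where x: "reachable (relabel f M) (f s) x" "sat (relabel f M) \<phi> x"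
      "\<forall>\<xi>. Globally \<xi> \<in> deg M s X \<longrightarrow> \<not> sat (relabel f M) (Prob (Globally \<xi>) GE 1) x" by blast
    obtain u where u: "x = f u" "reachable M s u" using reachable_relabelD[OF x(1) s] by blast
    note uS = reachable_states[OF u(2) s]
    show ?R using x(2,3) u(2) unfolding u(1) sat_relabel[OF uS] by blast
  next
    assume ?R
    then obtain u where u: "reachable M s u" "sat M \<phi> u"
      "\<forall>\<xi>. Globally \<xi> \<in> deg M s X \<longrightarrow> \<not> sat M (Prob (Globally \<xi>) GE 1) u" by blast
    note uS = reachable_states[OF u(1) s]
    show ?L
      using reachable_relabelI[OF u(1) s] u(2,3) unfolding sat_relabel[OF uS, symmetric] by blast
  qed
  then show ?thesis unfolding cf_def deg_relabel[OF s] sat_relabel[OF s] by simp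
qed

lemma set_norm_relabel: "s \<in> S \<Longrightarrow> set_norm (relabel f M) (f s) X = set_norm M s X"
  unfolding set_norm_def by (simp only: deg_relabel cf_relabel)

end

end

subsection \<open>Small models\<close>

lemma uniform_gap_below_1:
  fixes Q :: "real set"
  assumes "finite Q" and "\<And>q. q \<in> Q \<Longrightarrow> q < 1"
  obtains e where "0 < e" "e < 1" "\<And>q. q \<in> Q \<Longrightarrow> q < 1 - e"
proof
  \<comment> \<open>Including 0 makes the maximum meaningful for empty \<open>Q\<close> and keeps
    the gap \<open>(1 - m) / 2\<close> below 1.\<close>
  define m where "m = Max (insert 0 Q)"
  have m: "m < 1" "0 \<le> m" "\<And>q. q \<in> Q \<Longrightarrow> q \<le> m" using assms by (auto simp: m_def)
  show "0 < (1 - m) / 2" "(1 - m) / 2 < 1" using m by auto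
  show "q < 1 - (1 - m) / 2" if "q \<in> Q" for q
    using m(3)[OF that] m(1) by (simp add: field_simps)
qed

lemma geometric_bound_mono:
  fixes b c k l :: nat
  assumes "b \<le> c" "k \<le> l"
  shows "2 ^ b * (\<Sum>i\<le>k. b ^ i) \<le> 2 ^ c * (\<Sum>i\<le>l. c ^ i)"
proof -
  have "(\<Sum>i\<le>k. b ^ i) \<le> (\<Sum>i\<le>k. c ^ i)"
    using assms by (intro sum_mono power_mono) auto
  also have "\<dots> \<le> (\<Sum>i\<le>l. c ^ i)"
    using assms by (intro sum_mono2) auto
  finally show ?thesis
    using assms by (intro mult_mono power_increasing) auto
qed

text \<open>The loop costs at most \<open>2 ^ b\<close> states and at most \<open>b\<close> copies
  are attached, so the geometric sum grows by one Horner step.\<close>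

lemma (in loop_model) card_states_le:
  assumes "Suc n \<le> 2 ^ b" "card T \<le> b" "\<And>t. t \<in> T \<Longrightarrow> card (states (N t)) \<le> 2 ^ b * (\<Sum>i\<le>k. b ^ i)"
  shows "card (states M') \<le> 2 ^ b * (\<Sum>i\<le>Suc k. b ^ i)"
proof -
  have "card (states M') \<le> card ({0 :: nat} \<times> {..n}) + card (\<Union>t\<in>T. {Suc t} \<times> states (N t))"
    unfolding states_M' by (rule card_Un_le)
  also have "card (\<Union>t\<in>T. {Suc t} \<times> states (N t)) \<le> (\<Sum>t\<in>T. card ({Suc t} \<times> states (N t)))"
    using T by (rule card_UN_le)
  also have "\<dots> \<le> (\<Sum>t\<in>T. 2 ^ b * (\<Sum>i\<le>k. b ^ i))"
    using assms(3) by (intro sum_mono) (simp add: card_cartesian_product_singleton)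
  also have "\<dots> \<le> b * (2 ^ b * (\<Sum>i\<le>k. b ^ i))"
    using assms(2) by simp
  also have "card ({0 :: nat} \<times> {..n}) \<le> 2 ^ b"
    using assms(1) by (simp add: card_cartesian_product_singleton)
  also have "2 ^ b + b * (2 ^ b * (\<Sum>i\<le>k. b ^ i)) = 2 ^ b * (\<Sum>i\<le>Suc k. b ^ i)"
    by (simp only: sum.atMost_Suc_shift) (simp add: distrib_left mult.left_commute flip: sum_distrib_left)
  finally show ?thesis by simp
qed

text \<open>Induction on the norm, with \<open>M\<close> fixed while \<open>s\<close> and
  \<open>X\<close> vary. States are natural numbers because \<open>progressive\<close> speaks about
  such chains and because submodels of one common type are needed for gluing.\<close>

lemma small_model_nat:
  fixes M :: "(nat, 'a) markov_chain"
  assumes frag: "pctl_fragment \<L>" and prog: "progressive \<L>" and M: "finite_chain M"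
    and "s \<in> states M" "finite X" "X \<subseteq> \<L>" "X = UC M s X" "\<forall>\<phi>\<in>X. sat M \<phi> s"
  shows "\<exists>(N :: (nat, 'a) markov_chain) r. finite_chain N \<and> r \<in> states N \<and>
    card (states N) \<le> 2 ^ branching X * (\<Sum>i\<le>set_norm M s X. branching X ^ i) \<and> (\<forall>\<phi>\<in>X. sat N \<phi> r)"
  using assms(4-)
proof (induction "set_norm M s X" arbitrary: s X rule: less_induct)
  case less
  interpret finite_chain M by (rule M)
  note s = less.prems(1) and X = less.prems(2)
  \<comment> \<open>The norm is at least 1 by its leading summand, so \<open>k\<close> is its
    predecessor and bounds the norm of every submodel's obligations.\<close>
  define b k where "b = branching X" and "k = set_norm M s X - 1"
  have k: "set_norm M s X = Suc k" by (simp add: k_def set_norm_def)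
  obtain n L where loop: "progress_loop M s X n L"
    using prog[unfolded progressive_def, THEN spec, of M, THEN spec, of s, THEN spec, of X, THEN mp,
        OF conjI[OF chain conjI[OF fin conjI[OF s conjI[OF X conjI[OF less.prems(3)
        conjI[OF less.prems(5) less.prems(4)]]]]]]]
    by blast
  note pl = loop[unfolded progress_loop_def]
  define \<Delta> where "\<Delta> = loop_delta n L"
  define D where "D = {\<Phi>. \<exists>c q. Prob \<Phi> c q \<in> \<Delta>}"
  have L_sub: "L i \<subseteq> subs X" if "i \<le> n" for i using pl that by blast
  have inj_L: "inj_on L {..n}" using pl by blast
  have local: "\<forall>i\<le>n.
        (\<forall>a. Prop a \<in> L i \<longrightarrow> NProp a \<notin> L i) \<and>
        (\<forall>\<phi>1 \<phi>2. And \<phi>1 \<phi>2 \<in> L i \<longrightarrow> \<phi>1 \<in> L i \<and> \<phi>2 \<in> L i) \<and>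
        (\<forall>\<phi>1 \<phi>2. Or \<phi>1 \<phi>2 \<in> L i \<longrightarrow> \<phi>1 \<in> L i \<or> \<phi>2 \<in> L i) \<and>
        (\<forall>\<phi> c r. Prob (Globally \<phi>) c r \<in> L i \<longrightarrow> (\<forall>j\<le>n. \<phi> \<in> L j))"
    using pl by (elim conjE)
  note local_at = local[THEN spec, THEN mp]
  have lit: "NProp a \<notin> L i" if "i \<le> n" "Prop a \<in> L i" for i a
    by (rule local_at[OF that(1), THEN conjunct1, THEN spec, THEN mp, OF that(2)])
  have conj: "\<phi> \<in> L i \<and> \<psi> \<in> L i" if "i \<le> n" "And \<phi> \<psi> \<in> L i" for i \<phi> \<psi>
    by (rule local_at[OF that(1), THEN conjunct2, THEN conjunct1, THEN spec, THEN spec, THEN mp,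
          OF that(2)])
  have disj: "\<phi> \<in> L i \<or> \<psi> \<in> L i" if "i \<le> n" "Or \<phi> \<psi> \<in> L i" for i \<phi> \<psi>
    by (rule local_at[OF that(1), THEN conjunct2, THEN conjunct2, THEN conjunct1, THEN spec, THEN spec,
          THEN mp, OF that(2)])
  have glob: "\<phi> \<in> L j" if "i \<le> n" "j \<le> n" "Prob (Globally \<phi>) c q \<in> L i" for i j \<phi> c q
    by (rule local_at[OF that(1), THEN conjunct2, THEN conjunct2, THEN conjunct2, THEN spec, THEN spec,
          THEN spec, THEN mp, OF that(3), THEN spec, THEN mp, OF that(2)])
  have \<Delta>_sub: "\<Delta> \<subseteq> subs X" using L_sub by (auto simp: \<Delta>_def loop_delta_def)
  have \<Delta>_sat: "sat M \<phi> s" if "\<phi> \<in> \<Delta>" for \<phi> using pl that unfolding \<Delta>_def by blast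
  have \<Delta>_not: "\<not> sat M \<phi> s" if "Finally \<phi> \<in> D" for \<phi> using pl that unfolding \<Delta>_def D_def by blast
  have \<Delta>_cf: "cf M s \<Delta> \<subseteq> cf M s X" using pl unfolding \<Delta>_def by blast
  have bound: "valid_bound c q" if "Prob \<Phi> c q \<in> subs X" for \<Phi> c q
    by (rule fragment_valid_bound[OF frag subsetD[OF subs_fragment[OF frag less.prems(3)] that]])
  have D: "D \<subseteq> psub X" using \<Delta>_sub unfolding D_def psub_def by blast
  have finD: "finite D" using D finite_psub[OF X] finite_subset by blast
  have D_pos: "0 < path_prob M s \<Phi>" if \<Phi>: "\<Phi> \<in> D" for \<Phi>
  proof -
    obtain c q where cq: "Prob \<Phi> c q \<in> \<Delta>" using \<Phi> by (auto simp: D_def)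
    show ?thesis by (rule path_prob_pos[OF bound[OF subsetD[OF \<Delta>_sub cq]] \<Delta>_sat[OF cq]])
  qed
  have D_cf: "Finally \<phi> \<in> cf M s X"
    if "Finally \<phi> \<in> D" "reachable M s u" "sat M \<phi> u"
      "\<And>\<xi>. Globally \<xi> \<in> deg M s X \<Longrightarrow> \<not> sat M (Prob (Globally \<xi>) GE 1) u" for \<phi> u
  proof -
    \<comment> \<open>A state avoiding certainty for all of \<open>deg M s X\<close> also avoids it
      for the smaller \<open>deg M s \<Delta>\<close>. The eventuality thus lies in
      \<open>cf M s \<Delta>\<close>, and the loop condition on \<open>cf\<close> carries it over to
      \<open>X\<close>.\<close>
    have "deg M s \<Delta> \<subseteq> deg M s X"
      using psub_mono_subs[OF \<Delta>_sub] unfolding deg_def by blast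
    then have "\<forall>\<xi>. Globally \<xi> \<in> deg M s \<Delta> \<longrightarrow> \<not> sat M (Prob (Globally \<xi>) GE 1) u"
      using that(4) by blast
    moreover have "\<exists>c q. Prob (Finally \<phi>) c q \<in> \<Delta>" using that(1) by (simp add: D_def)
    ultimately have "Finally \<phi> \<in> cf M s \<Delta>"
      using that(2,3) \<Delta>_not[OF that(1)] unfolding cf_def by blast
    with \<Delta>_cf show ?thesis by blast
  qed
  \<comment> \<open>The stopping set: at its states the residual obligations have a smaller norm,
    and outside it the hypotheses of \<open>exit_distribution\<close> hold.\<close>
  define B where "B = {t. reachable M s t \<and>
    ((\<exists>\<xi>. Globally \<xi> \<in> deg M s X \<and> sat M (Prob (Globally \<xi>) GE 1) t) \<or> (\<exists>\<phi>. Finally \<phi> \<in> D \<and> sat M \<phi> t))}"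
  have "\<exists>(N :: (nat, 'a) markov_chain) r. finite_chain N \<and> r \<in> states N \<and>
      card (states N) \<le> 2 ^ b * (\<Sum>i\<le>k. b ^ i) \<and> (\<forall>\<Phi>\<in>D. path_prob M t \<Phi> \<le> path_prob N r \<Phi>)"
    if t: "t \<in> B" for t
  proof -
    let ?Z = "residual t D" let ?Y = "UC M t ?Z"
    have reach: "reachable M s t" using t by (simp add: B_def)
    note top = residual_top_level[OF D, of t]
    have norm: "set_norm M t ?Y < set_norm M s X"
      by (rule set_norm_residual_less[OF s reach X D D_cf]) (use t in \<open>auto simp: B_def\<close>)
    have "?Z \<subseteq> (\<lambda>\<Phi>. Prob \<Phi> GE (path_prob M t \<Phi>)) ` D" by (auto simp: residual_def)
    then have finZ: "finite ?Z" by (rule finite_surj[OF finD])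
    have Z_frag: "?Z \<subseteq> \<L>"
    proof
      fix \<psi> assume "\<psi> \<in> ?Z"
      then obtain \<Phi> where \<Phi>: "\<psi> = Prob \<Phi> GE (path_prob M t \<Phi>)" "\<Phi> \<in> D" "0 < path_prob M t \<Phi>"
        by (auto simp: residual_def)
      then obtain c q where "Prob \<Phi> c q \<in> \<Delta>" by (auto simp: D_def)
      then have "Prob \<Phi> c q \<in> \<L>"
        using \<Delta>_sub subs_fragment[OF frag less.prems(3)] by blast
      moreover have "valid_bound GE (path_prob M t \<Phi>)" using \<Phi>(3) by simp
      ultimately show "\<psi> \<in> \<L>" unfolding \<Phi>(1) by (rule fragment_change_bound[OF frag])
    qed
    have "\<exists>(N :: (nat, 'a) markov_chain) r. finite_chain N \<and> r \<in> states N \<and>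
      card (states N) \<le> 2 ^ branching ?Y * (\<Sum>i\<le>set_norm M t ?Y. branching ?Y ^ i) \<and>
      (\<forall>\<phi>\<in>?Y. sat N \<phi> r)"
    proof (rule less.hyps[OF norm])
      show "t \<in> states M" using reachable_states[OF reach s] .
      show "finite ?Y" using finZ by (rule finite_UC)
      show "?Y \<subseteq> \<L>" by (rule UC_fragment[OF frag Z_frag]) (rule residual_sat)
      show "?Y = UC M t ?Y" by (rule UC_idem[symmetric])
      show "\<forall>\<phi>\<in>?Y. sat M \<phi> t" by (rule ballI, rule UC_sat[OF residual_sat])
    qed
    then obtain N :: "(nat, 'a) markov_chain" and r where N: "finite_chain N" "r \<in> states N"
      "card (states N) \<le> 2 ^ branching ?Y * (\<Sum>i\<le>set_norm M t ?Y. branching ?Y ^ i)"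
      "\<forall>\<phi>\<in>?Y. sat N \<phi> r" by blast
    have "set_norm M t ?Y \<le> k" using norm k by simp
    with branching_UC[OF top X, of M t] N(3) have "card (states N) \<le> 2 ^ b * (\<Sum>i\<le>k. b ^ i)"
      unfolding b_def by (meson geometric_bound_mono order_trans)
    moreover have "path_prob M t \<Phi> \<le> path_prob N r \<Phi>" if "\<Phi> \<in> D" for \<Phi>
    proof (cases "0 < path_prob M t \<Phi>")
      case True
      with that have "Prob \<Phi> GE (path_prob M t \<Phi>) \<in> ?Z" by (auto simp: residual_def)
      from bspec[OF N(4) UC_base[OF this, of M t]] have "sat N (Prob \<Phi> GE (path_prob M t \<Phi>)) r"
        by (simp only: update_fm.simps)
      then show ?thesis by (simp only: sat_Prob_iff holds.simps)
    next
      case False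
      then show ?thesis using path_prob_nonneg[of N r \<Phi>] by linarith
    qed
    ultimately show ?thesis using N(1,2) by blast
  qed
  then obtain N :: "nat \<Rightarrow> (nat, 'a) markov_chain" and r where N: "\<And>t. t \<in> B \<Longrightarrow> finite_chain (N t)"
    "\<And>t. t \<in> B \<Longrightarrow> r t \<in> states (N t)"
    "\<And>t. t \<in> B \<Longrightarrow> card (states (N t)) \<le> 2 ^ b * (\<Sum>i\<le>k. b ^ i)"
    "\<And>t \<Phi>. t \<in> B \<Longrightarrow> \<Phi> \<in> D \<Longrightarrow> path_prob M t \<Phi> \<le> path_prob (N t) (r t) \<Phi>"
    by metis
  have card_D: "card D + 1 \<le> b"
    using card_mono[OF finite_psub[OF X] D] by (simp add: b_def branching_def)
  \<comment> \<open>The loop entries are pairwise different subsets of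
    \<open>subs X\<close>.\<close>
  have "card {..n} \<le> card (Pow (subs X))"
    using L_sub inj_L finite_subs[OF X] by (intro card_inj_on_le[of L]) auto
  also have "\<dots> = 2 ^ card (subs X)" using finite_subs[OF X] by (rule card_Pow)
  also have "\<dots> \<le> 2 ^ b"
    using card_subs_le[OF X less.prems(4)] by (intro power_increasing) (simp_all add: b_def)
  finally have card_n: "Suc n \<le> 2 ^ b" by simp
  \<comment> \<open>The gluing common to both alternatives of \<open>exit_distribution\<close>:
    build the loop model for given exit data, then return to natural numbers by
    \<open>prod_encode\<close>.\<close>
  have assemble: ?case
    if model: "loop_model \<epsilon> \<mu> T N r" and T: "T \<subseteq> B" "card T \<le> b"
      and small: "\<And>\<Phi> c q. Prob \<Phi> c q \<in> subs X \<Longrightarrow> q < 1 \<Longrightarrow> q < 1 - \<epsilon>"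
      and exit: "\<And>\<Phi>. 0 < \<epsilon> \<Longrightarrow> \<Phi> \<in> D \<Longrightarrow>
        path_prob M s \<Phi> \<le> measure_pmf.expectation \<mu> (\<lambda>t. path_prob (N t) (r t) \<Phi>)"
      and no_exit: "\<And>\<Phi>. \<epsilon> = 0 \<Longrightarrow> \<Phi> \<in> D \<Longrightarrow> \<exists>\<xi>. \<Phi> = Globally \<xi>" for \<epsilon> \<mu> T
  proof -
    interpret lm: loop_model n L \<epsilon> \<mu> T N r by (rule model)
    have in_D: "\<Phi> \<in> D" if "Prob \<Phi> c q \<in> loop_delta n L" for \<Phi> c q
      using that by (auto simp: D_def \<Delta>_def)
    have exit_holds: "holds c (lm.exit_prob \<Phi>) q"
      if "0 < \<epsilon>" "Prob \<Phi> c q \<in> loop_delta n L" for \<Phi> c q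
    proof -
      have "holds c (path_prob M s \<Phi>) q"
        using \<Delta>_sat[unfolded \<Delta>_def, OF that(2)] by (simp only: sat_Prob_iff)
      moreover have "path_prob M s \<Phi> \<le> lm.exit_prob \<Phi>"
        unfolding lm.exit_prob_def by (rule exit[OF that(1) in_D[OF that(2)]])
      ultimately show ?thesis by (cases c) auto
    qed
    have small_L: "q < 1 - \<epsilon>" if "i \<le> n" "Prob \<Phi> c q \<in> L i" "q < 1" for i \<Phi> c q
      by (rule small[OF subsetD[OF L_sub[OF that(1)] that(2)] that(3)])
    have bound_L: "valid_bound c q" if "i \<le> n" "Prob \<Phi> c q \<in> L i" for i \<Phi> c q
      by (rule bound[OF subsetD[OF L_sub[OF that(1)] that(2)]])
    have no_exit_L: "\<exists>\<xi>. \<Phi> = Globally \<xi>" if "\<epsilon> = 0" "Prob \<Phi> c q \<in> loop_delta n L" for \<Phi> c q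
      by (rule no_exit[OF that(1) in_D[OF that(2)]])
    have sat: "sat lm.M' \<phi> (0, i)" if "i \<le> n" "\<phi> \<in> L i" for i \<phi>
      by (rule lm.sat_loop)
        (fact lit conj disj glob bound_L small_L exit_holds no_exit_L that)+
    obtain i where i: "i \<le> n" "X \<subseteq> L i" using pl by blast
    have inj: "inj_on prod_encode (states lm.M')" by (rule inj_prod_encode)
    note in_M' = lm.loop_state[OF i(1)]
    have "finite_chain (relabel prod_encode lm.M')" by (rule lm.M'.finite_chain_relabel[OF inj])
    moreover have "prod_encode (0, i) \<in> states (relabel prod_encode lm.M')"
      using in_M' by (simp add: lm.M'.states_relabel[OF inj])
    moreover have "card (states (relabel prod_encode lm.M')) \<le> 2 ^ b * (\<Sum>j\<le>Suc k. b ^ j)"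
      using lm.card_states_le[OF card_n T(2)] N(3) T(1)
      by (auto simp: lm.M'.states_relabel[OF inj] card_image[OF inj])
    moreover have "\<forall>\<phi>\<in>X. sat (relabel prod_encode lm.M') \<phi> (prod_encode (0, i))"
      using sat i by (auto simp: lm.M'.sat_relabel[OF inj in_M'])
    ultimately show ?case unfolding k b_def[symmetric] by blast
  qed
  have "(\<forall>\<Phi>\<in>D. \<exists>\<xi>. \<Phi> = Globally \<xi>) \<or>
    (\<exists>\<mu>. set_pmf \<mu> \<subseteq> B \<and> card (set_pmf \<mu>) \<le> card D + 1 \<and>
       (\<forall>\<Phi>\<in>D. path_prob M s \<Phi> \<le> measure_pmf.expectation \<mu> (\<lambda>t. path_prob M t \<Phi>)))"
  proof (rule exit_distribution[OF s _ finD])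
    show "B \<subseteq> {u. reachable M s u}" by (auto simp: B_def)
    show "\<not> sat M \<phi> u" if "Finally \<phi> \<in> D" "reachable M s u" "u \<notin> B" for \<phi> u
      using that by (auto simp: B_def)
    show "path_prob M u (Globally \<xi>) \<noteq> 1" if "Globally \<xi> \<in> D" "path_prob M s (Globally \<xi>) \<noteq> 1"
      "reachable M s u" "u \<notin> B" for \<xi> u
    proof -
      \<comment> \<open>A \<open>Globally\<close> formula that is not certain at \<open>s\<close>
        belongs to \<open>deg\<close>, so every reachable state where it becomes certain is in
        \<open>B\<close>.\<close>
      have "Globally \<xi> \<in> deg M s X"
        using that(1,2) D unfolding deg_def sat_Globally_1 by blast
      then show ?thesis using that(3,4) unfolding B_def sat_Globally_1 by blast
    qed
  qed (rule D_pos)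
  then show ?case
  proof
    assume *: "\<forall>\<Phi>\<in>D. \<exists>\<xi>. \<Phi> = Globally \<xi>"
    show ?case
      \<comment> \<open>No exit at all: \<open>return_pmf 0\<close> is a dummy distribution and no
        copies are attached.\<close>
      by (rule assemble[of 0 "return_pmf 0" "{}"]) (use * in \<open>auto simp: loop_model_def\<close>)
  next
    assume "\<exists>\<mu>. set_pmf \<mu> \<subseteq> B \<and> card (set_pmf \<mu>) \<le> card D + 1 \<and>
       (\<forall>\<Phi>\<in>D. path_prob M s \<Phi> \<le> measure_pmf.expectation \<mu> (\<lambda>t. path_prob M t \<Phi>))"
    then obtain \<mu> where \<mu>: "set_pmf \<mu> \<subseteq> B" "card (set_pmf \<mu>) \<le> card D + 1"
      "\<And>\<Phi>. \<Phi> \<in> D \<Longrightarrow> path_prob M s \<Phi> \<le> measure_pmf.expectation \<mu> (\<lambda>t. path_prob M t \<Phi>)" by blast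
    have "B \<subseteq> S" using reachable_states[OF _ s] by (auto simp: B_def)
    then have fin_\<mu>: "finite (set_pmf \<mu>)" using \<mu>(1) fin by (meson finite_subset)
    \<comment> \<open>The finitely many bounds below 1; the exit probability \<open>e\<close> must
      be smaller than their distance from 1.\<close>
    define Q where "Q = {q. q < 1 \<and> (\<exists>\<Phi> c. Prob \<Phi> c q \<in> subs X)}"
    have "Q \<subseteq> (\<lambda>\<phi>. case \<phi> of Prob \<Phi> c q \<Rightarrow> q) ` subs X" by (force simp: Q_def)
    then have "finite Q" by (rule finite_surj[OF finite_subs[OF X]])
    then obtain e where e: "0 < e" "e < 1" "\<And>q. q \<in> Q \<Longrightarrow> q < 1 - e"
      by (rule uniform_gap_below_1) (auto simp: Q_def)
    show ?case
    proof (rule assemble[of e \<mu> "set_pmf \<mu>"])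
      show "loop_model e \<mu> (set_pmf \<mu>) N r"
        by (rule loop_model.intro) (use fin_\<mu> N(1,2) \<mu>(1) e in auto)
      show "q < 1 - e" if "Prob \<Phi> c q \<in> subs X" "q < 1" for \<Phi> c q
        using that e(3)[of q] by (auto simp: Q_def)
      show "path_prob M s \<Phi> \<le> measure_pmf.expectation \<mu> (\<lambda>t. path_prob (N t) (r t) \<Phi>)"
        if "\<Phi> \<in> D" for \<Phi>
      proof -
        have "measure_pmf.expectation \<mu> (\<lambda>t. path_prob M t \<Phi>) \<le>
            measure_pmf.expectation \<mu> (\<lambda>t. path_prob (N t) (r t) \<Phi>)"
          by (intro integral_mono_AE integrable_measure_pmf_finite fin_\<mu>)
            (use N(4)[OF _ that] \<mu>(1) in \<open>auto simp: AE_measure_pmf_iff\<close>)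
        with \<mu>(3)[OF that] show ?thesis by linarith
      qed
    qed (use \<mu> e card_D in auto)
  qed
qed

theorem theorem2:
  fixes \<L> :: "'a state_fm set"
    and M :: "('s, 'a) markov_chain"
    and s :: 's
    and X :: "'a state_fm set"
  assumes "pctl_fragment \<L>" and "progressive \<L>"
    and "is_markov_chain M" and "finite (states M)" and "s \<in> states M"
    and "finite X" and "X \<subseteq> \<L>"
    and "X = UC M s X"
    and "\<forall>\<phi>\<in>X. sat M \<phi> s"
  shows "\<exists>(M' :: (nat, 'a) markov_chain) s'.
    is_markov_chain M' \<and> s' \<in> states M' \<and> finite (states M') \<and>
    real (card (states M')) \<le>
      2 ^ branching X * ((real (branching X) ^ (set_norm M s X + 1) - 1) / (real (branching X) - 1)) \<and>
    (\<forall>\<phi>\<in>X. sat M' \<phi> s')"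
proof -
  interpret finite_chain M using assms by unfold_locales
  obtain f :: "'s \<Rightarrow> nat" where f: "inj_on f S"
    using finite_imp_inj_to_nat_seg[OF fin] by blast
  let ?M = "relabel f M"
  have "\<exists>(N :: (nat, 'a) markov_chain) r. finite_chain N \<and> r \<in> states N \<and>
    card (states N) \<le> 2 ^ branching X * (\<Sum>i\<le>set_norm ?M (f s) X. branching X ^ i) \<and> (\<forall>\<phi>\<in>X. sat N \<phi> r)"
  proof (rule small_model_nat[OF assms(1,2) finite_chain_relabel[OF f] _ assms(6,7)])
    show "f s \<in> states ?M" using assms(5) by (simp add: states_relabel[OF f])
    show "X = UC ?M (f s) X" unfolding UC_relabel[OF f assms(5)] by (rule assms(8))
    show "\<forall>\<phi>\<in>X. sat ?M \<phi> (f s)" using assms(9) by (simp add: sat_relabel[OF f assms(5)])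
  qed
  then obtain N :: "(nat, 'a) markov_chain" and r where N: "finite_chain N" "r \<in> states N"
    "card (states N) \<le> 2 ^ branching X * (\<Sum>i\<le>set_norm M s X. branching X ^ i)" "\<forall>\<phi>\<in>X. sat N \<phi> r"
    unfolding set_norm_relabel[OF f assms(5)] by blast
  \<comment> \<open>The summand 2 in \<open>branching\<close> rules out base 1, so the geometric sum
    has its closed form.\<close>
  have "real (branching X) \<noteq> 1" by (simp add: branching_def)
  from geometric_sum[OF this, of "set_norm M s X + 1"]
  have "(\<Sum>i\<le>set_norm M s X. real (branching X) ^ i) =
      (real (branching X) ^ (set_norm M s X + 1) - 1) / (real (branching X) - 1)"
    by (simp add: lessThan_Suc_atMost)
  moreover have "real (card (states N)) \<le>
      real (2 ^ branching X * (\<Sum>i\<le>set_norm M s X. branching X ^ i))"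
    using N(3) by (simp only: of_nat_le_iff)
  ultimately have "real (card (states N)) \<le> 2 ^ branching X *
      ((real (branching X) ^ (set_norm M s X + 1) - 1) / (real (branching X) - 1))"
    by simp
  with N show ?thesis
    using finite_chain.chain finite_chain.fin by blast
qed

end
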